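(* Let $\mathbb F$ be an algebraically closed field of characteristic zero, $V=\mathbb F^4$, $G=\mathbb Z_2^3$, and let $V^\sigma[G^\times]$ be the Lie algebra defined in the context. The three non-equivalent irreducible representations of dimension $8$ of $V^\sigma[G^\times]$ are given by the linear maps $\rho_k\colon V^\sigma[G^\times]\to\mathfrak{gl}_8(\mathbb F)$, $k=1,2,3$, determined by $$\begin{array}{l}\rho_1((a,b,c,d)g_i)=\delta(i)_{(a,b,c,d)},\\ \rho_2((a,b,c,d)g_i)=\delta(i)_{(a,b,c,d)-\frac{a+b+c-d}{2}(1,1,1,-1)},\\ \rho_3((a,b,c,d)g_i)=\delta(i)_{(a,b,c,d)-\frac{a+b+c+d}{2}(1,1,1,1)},\end{array}$$ for $i\in I=\{1,\dots,7\}$, $(a,b,c,d)\in V$, where, for $\{e_0,\dots,e_7\}$ the canonical basis of $\mathbb F^8$, $\delta(i)_{(a,b,c,d)}\colon\mathbb F^8\to\mathbb F^8$ denotes the linear map $$\begin{array}{llll}e_{i+1}\mapsto ae_{i+3},& e_{i+2}\mapsto be_{i+6},& e_{i+4}\mapsto ce_{i+5},& e_0\mapsto de_i,\\ e_{i+3}\mapsto -ae_{i+1},& e_{i+6}\mapsto -be_{i+2},& e_{i+5}\mapsto -ce_{i+4},& e_i\mapsto -de_0.\end{array}$$ That is, $\rho_1,\rho_2,\rho_3$ are irreducible Lie algebra representations, pairwise non-equivalent, and every irreducible representation of dimension $8$ of $V^\sigma[G^\times]$ is equivalent to one of them.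
   Context: Labelling of $G=\mathbb Z_2^3$: $g_0=(0,0,0)$, $g_1=(1,0,0)$, $g_2=(0,1,0)$, $g_3=(0,0,1)$, $g_4=(1,1,0)$, $g_5=(0,1,1)$, $g_6=(1,1,1)$, $g_7=(1,0,1)$. With $I=\{1,\dots,7\}$, sums of indices such as $i+1$ (with $i\in I$) are taken modulo $7$ with values in $I$ (residue $0$ is represented by $7$; the index $0$ is distinct and denotes the neutral element, respectively the basis vector $e_0$). $G^\times=G\setminus\{g_0\}$. $V^\sigma[G^\times]$ is the vector space of formal sums $\sum_{i\in I}r_ig_i$, $r_i\in V$, with bracket obtained by bilinear extension from $[rg_i,sg_j]=\sigma_{i,j}(r,s)(g_i+g_j)$, where, for $r=(a_1,a_2,a_3,a_4)$, $s=(b_1,b_2,b_3,b_4)$, $i\in I$, $\sigma_{i,i+1}(r,s)=(-a_2b_1-a_3b_3,-a_2b_3-a_3b_1,a_1b_2+a_4b_4,a_1b_4+a_4b_2)$, $\sigma_{i,i+2}(r,s)=(a_2b_3+a_4b_4,-a_1b_1-a_3b_2,-a_1b_2-a_3b_1,a_2b_4+a_4b_3)$, $\sigma_{i,i+4}(r,s)=(-a_1b_2-a_2b_3,a_3b_1+a_4b_4,-a_1b_3-a_2b_2,a_3b_4+a_4b_1)$, $\sigma_{i,i}=0$ (so $[rg_i,sg_i]=0$), $\sigma_{i,i+3}(r,s)=-\sigma_{i,i+4}(s,r)$, $\sigma_{i,i+5}(r,s)=-\sigma_{i,i+2}(s,r)$, $\sigma_{i,i+6}(r,s)=-\sigma_{i,i+1}(s,r)$.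 It is a Lie algebra isomorphic to $\mathfrak{so}_8(\mathbb F)$. *)

theory Defs
  imports "HOL-Analysis.Analysis"
begin

section \<open>Lie algebra representations\<close>

text \<open>
  A Lie algebra is given by its underlying vector space (scalar multiplication \<open>sL\<close>) and its
  bracket \<open>br\<close>; a representation \<open>\<rho>\<close> on the vector space with scalar multiplication \<open>sW\<close> is a linear
  map into the endomorphisms of that space, preserving brackets.  Linearity of \<open>\<rho>\<close> is stated
  pointwise.  The predicate \<open>Vector_Spaces.linear\<close> includes that source and target are vector
  spaces.
\<close>

definition lie_rep ::
  "('a::field \<Rightarrow> 'l::ab_group_add \<Rightarrow> 'l) \<Rightarrow> ('l \<Rightarrow> 'l \<Rightarrow> 'l) \<Rightarrow>
   ('a \<Rightarrow> 'w::ab_group_add \<Rightarrow> 'w) \<Rightarrow> ('l \<Rightarrow> 'w \<Rightarrow> 'w) \<Rightarrow> bool" where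
  "lie_rep sL br sW \<rho> \<longleftrightarrow>
     (\<forall>x. Vector_Spaces.linear sW sW (\<rho> x)) \<and>
     (\<forall>w. Vector_Spaces.linear sL sW (\<lambda>x. \<rho> x w)) \<and>
     (\<forall>x y w. \<rho> (br x y) w = \<rho> x (\<rho> y w) - \<rho> y (\<rho> x w))"

definition irreducible_lie_rep ::
  "('a::field \<Rightarrow> 'l::ab_group_add \<Rightarrow> 'l) \<Rightarrow> ('l \<Rightarrow> 'l \<Rightarrow> 'l) \<Rightarrow>
   ('a \<Rightarrow> 'w::ab_group_add \<Rightarrow> 'w) \<Rightarrow> ('l \<Rightarrow> 'w \<Rightarrow> 'w) \<Rightarrow> bool" where
  "irreducible_lie_rep sL br sW \<rho> \<longleftrightarrow>
     lie_rep sL br sW \<rho> \<and>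
     (UNIV :: 'w set) \<noteq> {0} \<and>
     (\<forall>U. module.subspace sW U \<and> (\<forall>x. \<forall>u\<in>U. \<rho> x u \<in> U) \<longrightarrow> U = {0} \<or> U = UNIV)"

definition equivalent_reps ::
  "('a::field \<Rightarrow> 'v::ab_group_add \<Rightarrow> 'v) \<Rightarrow> ('l \<Rightarrow> 'v \<Rightarrow> 'v) \<Rightarrow>
   ('a \<Rightarrow> 'w::ab_group_add \<Rightarrow> 'w) \<Rightarrow> ('l \<Rightarrow> 'w \<Rightarrow> 'w) \<Rightarrow> bool" where
  "equivalent_reps sV \<phi> sW \<psi> \<longleftrightarrow>
     (\<exists>T. Vector_Spaces.linear sV sW T \<and> bij T \<and> (\<forall>x v. T (\<phi> x v) = \<psi> x (T v)))"


section \<open>The Lie algebra \<open>V\<^sup>\<sigma>[G\<^sup>\<times>]\<close>\<close>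

text \<open>
  The index set \<open>I = {1, \<dots>, 7}\<close> is the numeral type \<open>7\<close> of residues modulo 7, so that \<open>i + 1\<close> etc. are
  automatically taken modulo 7.  The index 7 is the element \<open>0\<close> of this type.  The index 0 of the
  neutral element \<open>g\<^sub>0\<close> is not an element of it.
\<close>

definition gel :: "7 \<Rightarrow> 2 \<times> 2 \<times> 2" where
  "gel i = (if i = 1 then (1,0,0) else if i = 2 then (0,1,0) else if i = 3 then (0,0,1)
     else if i = 4 then (1,1,0) else if i = 5 then (0,1,1) else if i = 6 then (1,1,1)
     else (1,0,1))"

text \<open>The bilinear maps \<open>\<sigma>\<^sub>i\<^sub>,\<^sub>i\<^sub>+\<^sub>1\<close>, \<open>\<sigma>\<^sub>i\<^sub>,\<^sub>i\<^sub>+\<^sub>2\<close> and \<open>\<sigma>\<^sub>i\<^sub>,\<^sub>i\<^sub>+\<^sub>4\<close>.\<close>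

definition sigma1 :: "'a::comm_ring_1 ^ 4 \<Rightarrow> 'a ^ 4 \<Rightarrow> 'a ^ 4" where
  "sigma1 a b = vector
     [- a$2 * b$1 - a$3 * b$3, - a$2 * b$3 - a$3 * b$1,
      a$1 * b$2 + a$4 * b$4, a$1 * b$4 + a$4 * b$2]"

definition sigma2 :: "'a::comm_ring_1 ^ 4 \<Rightarrow> 'a ^ 4 \<Rightarrow> 'a ^ 4" where
  "sigma2 a b = vector
     [a$2 * b$3 + a$4 * b$4, - a$1 * b$1 - a$3 * b$2,
      - a$1 * b$2 - a$3 * b$1, a$2 * b$4 + a$4 * b$3]"

definition sigma4 :: "'a::comm_ring_1 ^ 4 \<Rightarrow> 'a ^ 4 \<Rightarrow> 'a ^ 4" where
  "sigma4 a b = vector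
     [- a$1 * b$2 - a$2 * b$3, a$3 * b$1 + a$4 * b$4,
      - a$1 * b$3 - a$2 * b$2, a$3 * b$4 + a$4 * b$1]"

definition sig :: "7 \<Rightarrow> 7 \<Rightarrow> 'a::comm_ring_1 ^ 4 \<Rightarrow> 'a ^ 4 \<Rightarrow> 'a ^ 4" where
  "sig i j r s =
     (if j = i + 1 then sigma1 r s
      else if j = i + 2 then sigma2 r s
      else if j = i + 3 then - sigma4 s r
      else if j = i + 4 then sigma4 r s
      else if j = i + 5 then - sigma2 s r
      else if j = i + 6 then - sigma1 s r
      else 0)"

text \<open>
  The formal sum \<open>\<Sum>\<^sub>i r\<^sub>i g\<^sub>i\<close> is the vector \<open>x :: ('a ^ 4) ^ 7\<close> with \<open>x $ i = r\<^sub>i\<close>; thus \<open>r g\<^sub>i\<close> is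
  \<open>axis i r\<close>.
\<close>

definition scaleL :: "'a::comm_ring_1 \<Rightarrow> ('a ^ 4) ^ 7 \<Rightarrow> ('a ^ 4) ^ 7" where
  "scaleL c x = (\<chi> i. c *s x $ i)"

text \<open>
  The bilinear extension of \<open>[r g\<^sub>i, s g\<^sub>j] = \<sigma>\<^sub>i\<^sub>,\<^sub>j(r, s) (g\<^sub>i + g\<^sub>j)\<close>, by collecting the coefficient of
  each \<open>g\<^sub>k\<close>.  The pairs with \<open>i = j\<close>, for which \<open>g\<^sub>i + g\<^sub>j = g\<^sub>0\<close>, do not contribute.
\<close>

definition bracket :: "('a::comm_ring_1 ^ 4) ^ 7 \<Rightarrow> ('a ^ 4) ^ 7 \<Rightarrow> ('a ^ 4) ^ 7" where
  "bracket x y =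
     (\<chi> k. \<Sum>i\<in>UNIV. \<Sum>j\<in>UNIV. if gel i + gel j = gel k then sig i j (x $ i) (y $ j) else 0)"


section \<open>The maps \<open>\<rho>\<^sub>1\<close>, \<open>\<rho>\<^sub>2\<close>, \<open>\<rho>\<^sub>3\<close>\<close>

text \<open>
  \<open>pos\<close> sends the index \<open>i \<in> I\<close> (an element of the type \<open>7\<close>) to the corresponding index
  in \<open>{1, \<dots>, 7}\<close> of the coordinates \<open>0, \<dots>, 7\<close> of \<open>'a ^ 8\<close>; in particular it sends \<open>0 :: 7\<close>, which
  represents 7, to \<open>7 :: 8\<close>.
\<close>

definition pos :: "7 \<Rightarrow> 8" where
  "pos i = (if i = 1 then 1 else if i = 2 then 2 else if i = 3 then 3 else if i = 4 then 4
     else if i = 5 then 5 else if i = 6 then 6 else 7)"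

definition ebas :: "8 \<Rightarrow> 'a::comm_ring_1 ^ 8" where
  "ebas j = axis j 1"

definition delta :: "7 \<Rightarrow> 'a::comm_ring_1 ^ 4 \<Rightarrow> 'a ^ 8 \<Rightarrow> 'a ^ 8" where
  "delta i v x =
     v$1 *s (x $ pos (i+1) *s ebas (pos (i+3)) - x $ pos (i+3) *s ebas (pos (i+1))) +
     v$2 *s (x $ pos (i+2) *s ebas (pos (i+6)) - x $ pos (i+6) *s ebas (pos (i+2))) +
     v$3 *s (x $ pos (i+4) *s ebas (pos (i+5)) - x $ pos (i+5) *s ebas (pos (i+4))) +
     v$4 *s (x $ 0 *s ebas (pos i) - x $ pos i *s ebas 0)"

definition rho1 :: "('a::field ^ 4) ^ 7 \<Rightarrow> 'a ^ 8 \<Rightarrow> 'a ^ 8" where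
  "rho1 x w = (\<Sum>i\<in>UNIV. delta i (x $ i) w)"

definition rho2 :: "('a::field ^ 4) ^ 7 \<Rightarrow> 'a ^ 8 \<Rightarrow> 'a ^ 8" where
  "rho2 x w = (\<Sum>i\<in>UNIV.
     delta i (x $ i - ((x$i$1 + x$i$2 + x$i$3 - x$i$4) / 2) *s vector [1, 1, 1, -1]) w)"

definition rho3 :: "('a::field ^ 4) ^ 7 \<Rightarrow> 'a ^ 8 \<Rightarrow> 'a ^ 8" where
  "rho3 x w = (\<Sum>i\<in>UNIV.
     delta i (x $ i - ((x$i$1 + x$i$2 + x$i$3 + x$i$4) / 2) *s vector [1, 1, 1, 1]) w)"


section \<open>The defining formulas on generators and basis vectors\<close>

lemma vector_4:
  "(vector [a, b, c, d] :: 'a::zero ^ 4) $ 1 = a"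
  "(vector [a, b, c, d] :: 'a ^ 4) $ 2 = b"
  "(vector [a, b, c, d] :: 'a ^ 4) $ 3 = c"
  "(vector [a, b, c, d] :: 'a ^ 4) $ 4 = d"
  by (simp_all add: vector_def)

lemma exhaust_7: "(i::7) = 1 \<or> i = 2 \<or> i = 3 \<or> i = 4 \<or> i = 5 \<or> i = 6 \<or> i = 0"
proof (induct i)
  case (of_int z)
  then have "z = 0 \<or> z = 1 \<or> z = 2 \<or> z = 3 \<or> z = 4 \<or> z = 5 \<or> z = 6" by fastforce
  then show ?case by auto
qed

lemma pos_inj: "pos i = pos j \<longleftrightarrow> i = j"
  using exhaust_7[of i] exhaust_7[of j] by (elim disjE) (simp_all add: pos_def)

lemma pos_nonzero: "pos i \<noteq> 0" "0 \<noteq> pos i"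
  using exhaust_7[of i] by (elim disjE; simp add: pos_def)+

lemma ebas_nth: "ebas p $ q = (if q = p then 1 else 0)"
  by (simp add: ebas_def axis_def)

lemma delta_ebas:
  fixes i :: 7 and a b c d :: "'a::field"
  defines "D \<equiv> delta i (vector [a, b, c, d])"
  shows "D (ebas (pos (i+1))) = a *s ebas (pos (i+3))"
    and "D (ebas (pos (i+2))) = b *s ebas (pos (i+6))"
    and "D (ebas (pos (i+4))) = c *s ebas (pos (i+5))"
    and "D (ebas 0) = d *s ebas (pos i)"
    and "D (ebas (pos (i+3))) = - a *s ebas (pos (i+1))"
    and "D (ebas (pos (i+6))) = - b *s ebas (pos (i+2))"
    and "D (ebas (pos (i+5))) = - c *s ebas (pos (i+4))"
    and "D (ebas (pos i)) = - d *s ebas 0"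
  by (simp_all add: D_def delta_def ebas_nth pos_inj pos_nonzero vector_4 vec.scale_minus_left)

lemma sig_zero:
  fixes r s :: "'a::comm_ring_1 ^ 4"
  shows "sig i j 0 s = 0" "sig i j r 0 = 0"
proof -
  have "vector [0, 0, 0, 0] = (0 :: 'a ^ 4)"
    by (simp add: vec_eq_iff forall_4 vector_4)
  then show "sig i j 0 s = 0" "sig i j r 0 = 0"
    by (simp_all add: sig_def sigma1_def sigma2_def sigma4_def)
qed

lemma gel_inj: "gel i = gel j \<longleftrightarrow> i = j"
  using exhaust_7[of i] exhaust_7[of j] by (elim disjE) (simp_all add: gel_def)

lemma gel_nonzero: "gel i + gel i \<noteq> gel k"
proof -
  have "gel i + gel i = 0"
    using exhaust_7[of i] by (elim disjE) (simp_all add: gel_def zero_prod_def)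
  moreover have "gel k \<noteq> 0"
    using exhaust_7[of k] by (elim disjE) (simp_all add: gel_def zero_prod_def)
  ultimately show ?thesis by simp
qed

lemma bracket_axis_nth:
  "bracket (axis i r) (axis j s) $ k = (if gel i + gel j = gel k then sig i j r s else 0)"
proof -
  have "bracket (axis i r) (axis j s) $ k =
    (\<Sum>i'\<in>UNIV. \<Sum>j'\<in>UNIV. if j' = j then
       if i' = i then if gel i + gel j = gel k then sig i j r s else 0 else 0 else 0)"
    unfolding bracket_def vec_lambda_beta
    by (intro sum.cong refl) (auto simp: axis_def sig_zero)
  also have "\<dots> = (if gel i + gel j = gel k then sig i j r s else 0)"
    by simp
  finally show ?thesis .
qed

lemma bracket_axis:
  assumes "gel i + gel j = gel k"
  shows "bracket (axis i r) (axis j s) = axis k (sig i j r s)"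
proof -
  have "bracket (axis i r) (axis j s) $ l = axis k (sig i j r s) $ l" for l
    unfolding bracket_axis_nth assms gel_inj by (auto simp: axis_def)
  then show ?thesis by (subst vec_eq_iff) blast
qed

lemma bracket_axis_same: "bracket (axis i r) (axis i s) = 0"
proof -
  have "bracket (axis i r) (axis i s) $ l = 0 $ l" for l
    unfolding bracket_axis_nth using gel_nonzero[of i l] by simp
  then show ?thesis by (subst vec_eq_iff) blast
qed

lemma sum_delta_axis:
  assumes "f 0 = 0"
  shows "(\<Sum>j\<in>UNIV. delta j (f (axis i v $ j)) w) = delta i (f v) w"
proof -
  have "(\<Sum>j\<in>UNIV. delta j (f (axis i v $ j)) w)
      = (\<Sum>j\<in>UNIV. if j = i then delta i (f v) w else 0)"
    by (intro sum.cong refl) (auto simp: axis_def assms delta_def)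
  then show ?thesis by simp
qed

lemma rho1_axis:
  "rho1 (axis i (vector [a, b, c, d])) = delta i (vector [a, b, c, d])"
  unfolding rho1_def fun_eq_iff by (rule allI, rule sum_delta_axis) simp

lemma rho2_axis:
  "rho2 (axis i (vector [a, b, c, d])) =
     delta i (vector [a, b, c, d] - ((a + b + c - d) / 2) *s vector [1, 1, 1, -1])"
  using sum_delta_axis[of "\<lambda>v. v - ((v$1 + v$2 + v$3 - v$4) / 2) *s vector [1, 1, 1, -1]" i
      "vector [a, b, c, d]"]
  by (simp add: rho2_def fun_eq_iff vector_4)

lemma rho3_axis:
  "rho3 (axis i (vector [a, b, c, d])) =
     delta i (vector [a, b, c, d] - ((a + b + c + d) / 2) *s vector [1, 1, 1, 1])"
  using sum_delta_axis[of "\<lambda>v. v - ((v$1 + v$2 + v$3 + v$4) / 2) *s vector [1, 1, 1, 1]" i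
      "vector [a, b, c, d]"]
  by (simp add: rho3_def fun_eq_iff vector_4)

end

theory Submission
  imports Defs
begin

text \<open>
  The operators \<open>E\<^sub>p\<^sub>q - E\<^sub>q\<^sub>p\<close> of \<open>\<rho>\<^sub>1\<close> identify the Lie algebra with \<open>so\<^sub>8\<close>, and \<open>\<rho>\<^sub>2\<close>, \<open>\<rho>\<^sub>3\<close>
  arise from \<open>\<rho>\<^sub>1\<close> by composing with involutive (triality) automorphisms that act on every coefficient
  in \<open>V\<close> by the same reflection.  In an irreducible representation of dimension 8 take joint
  eigenvectors of the Cartan subalgebra \<open>V g\<^sub>1\<close>.  In coordinates \<open>m\<^sub>1, \<dots>, m\<^sub>4\<close> dual to four pairwise
  orthogonal roots the weights are integral, and \<open>sl\<^sub>2\<close>-theory lets one move along root strings.  A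
  nonzero weight with all \<open>m\<^sub>i\<close> odd or all even generates the 16 weights \<open>(\<plusminus>1, \<plusminus>1, \<plusminus>1, \<plusminus>1)\<close>, which is
  too many; otherwise exactly two \<open>m\<^sub>i\<close> are odd, which leaves three types of representations, permuted
  by the triality automorphisms.  In the vector type the 8 weights found exhaust the space, hence
  disjoint rotations satisfy \<open>X\<^sub>p\<^sub>q X\<^sub>r\<^sub>s = 0\<close>.  It follows that some vector \<open>w \<noteq> 0\<close> is annihilated by
  the \<open>so\<^sub>7\<close> fixing \<open>e\<^sub>0\<close>, and \<open>e\<^sub>0 \<mapsto> w\<close>, \<open>e\<^sub>p \<mapsto> X\<^sub>p\<^sub>0 w\<close> is an isomorphism from \<open>\<rho>\<^sub>1\<close> by Schur's lemma.
\<close>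

section \<open>Eigenvectors and \<open>sl\<^sub>2\<close>-strings\<close>

locale ac_vector_space = finite_dimensional_vector_space sc Basis
  for sc :: "'a::{alg_closed_field, field_char_0} \<Rightarrow> 'w::ab_group_add \<Rightarrow> 'w" (infixr "\<odot>" 75)
    and Basis :: "'w set"
begin

abbreviation lin :: "('w \<Rightarrow> 'w) \<Rightarrow> bool" where
  "lin \<equiv> Vector_Spaces.linear sc sc"

lemma lin_simps:
  assumes "lin A"
  shows "A (x + y) = A x + A y" "A (x - y) = A x - A y" "A (- x) = - A x"
    "A 0 = 0" "A (c \<odot> x) = c \<odot> A x" "A (\<Sum>i\<in>I. f i) = (\<Sum>i\<in>I. A (f i))"
  using Vector_Spaces.linear.axioms(3)[OF assms]
  by (simp_all add: module_hom.add module_hom.diff module_hom.neg module_hom.zero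
      module_hom.scale module_hom.sum)

lemma linI:
  assumes "\<And>x y. A (x + y) = A x + A y" "\<And>c x. A (c \<odot> x) = c \<odot> A x"
  shows "lin A"
  using assms vector_space_axioms by (simp add: Vector_Spaces.linear_iff)

section \<open>Independence of eigenvectors with distinct eigenvalues\<close>

lemma independent_card_le_dimension: "independent B \<Longrightarrow> card B \<le> dimension"
  using independent_card_le_dim[of B UNIV] by (simp add: dim_UNIV dimension_def)

text \<open>Applying \<open>A - ev q\<close> to the relation kills the term of \<open>q\<close> and
  multiplies each other term by the nonzero factor \<open>ev k - ev q\<close>, which leaves a
  shorter relation.\<close>

lemma eigenvectors_sum_zero:
  assumes "lin A" "finite S" "inj_on ev S" "\<And>k. k \<in> S \<Longrightarrow> A (w k) = ev k \<odot> w k"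
    and "(\<Sum>k\<in>S. w k) = 0" "k \<in> S"
  shows "w k = 0"
  using assms(2-6)
proof (induction S arbitrary: w k)
  case (insert q S)
  note lin_simps = lin_simps[OF assms(1)]
  let ?w = "\<lambda>k. (ev k - ev q) \<odot> w k"
  have q: "w q = - (\<Sum>k\<in>S. w k)"
    using insert by (simp add: eq_neg_iff_add_eq_0)
  have "(\<Sum>k\<in>S. ?w k) = (\<Sum>k\<in>S. A (w k)) - ev q \<odot> (\<Sum>k\<in>S. w k)"
    using insert.prems(2) by (simp add: scale_left_diff_distrib sum_subtractf scale_sum_right)
  also have "\<dots> = A (- w q) - ev q \<odot> (- w q)"
    unfolding q by (simp add: lin_simps)
  also have "\<dots> = 0"
    using insert.prems(2)[of q] by (simp add: lin_simps)
  finally have sum: "(\<Sum>k\<in>S. ?w k) = 0" .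
  have zero: "w k = 0" if "k \<in> S" for k
  proof -
    have "?w k = 0"
      using insert.prems that by (intro insert.IH[OF _ _ sum that]) (auto simp: lin_simps mult.commute)
    moreover have "ev k \<noteq> ev q"
      using insert.prems(1) insert.hyps(2) that by (auto simp: inj_on_def)
    ultimately show ?thesis by simp
  qed
  then have "w q = 0" using q by simp
  with zero insert.prems(4) show ?case by blast
qed simp

lemma eigenvectors_inj:
  assumes "inj_on ev S" "\<And>k. k \<in> S \<Longrightarrow> A (w k) = ev k \<odot> w k" "\<And>k. k \<in> S \<Longrightarrow> w k \<noteq> 0"
  shows "inj_on w S"
proof (rule inj_onI)
  fix j k assume jk: "j \<in> S" "k \<in> S" "w j = w k"
  then have "ev j \<odot> w j = ev k \<odot> w j" using assms(2) by metis
  then have "ev j = ev k" using assms(3) jk by simp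
  then show "j = k" using assms(1) jk by (auto dest: inj_onD)
qed

lemma eigenvectors_independent:
  assumes "lin A" "finite S" "inj_on ev S" "\<And>k. k \<in> S \<Longrightarrow> A (w k) = ev k \<odot> w k"
    "\<And>k. k \<in> S \<Longrightarrow> w k \<noteq> 0"
  shows "independent (w ` S)" "card (w ` S) = card S"
proof -
  have inj: "inj_on w S" by (rule eigenvectors_inj[OF assms(3-5)])
  then show "card (w ` S) = card S" by (rule card_image)
  have "u (w k) = 0" if u: "(\<Sum>v\<in>w ` S. u v \<odot> v) = 0" and k: "k \<in> S" for u k
  proof -
    have "(\<Sum>k\<in>S. u (w k) \<odot> w k) = 0" using u inj by (simp add: sum.reindex)
    then have "u (w k) \<odot> w k = 0"
      using k assms by (intro eigenvectors_sum_zero[where w = "\<lambda>k. u (w k) \<odot> w k" and S = S])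
        (auto simp: lin_simps[OF assms(1)] mult.commute)
    then show ?thesis using assms(5) k by simp
  qed
  then show "independent (w ` S)" using assms(2) by (auto simp: dependent_finite)
qed

section \<open>Polynomials p(A) applied to a vector, and existence of eigenvectors\<close>

definition pact :: "('w \<Rightarrow> 'w) \<Rightarrow> 'a poly \<Rightarrow> 'w \<Rightarrow> 'w" where
  "pact A p v = (\<Sum>k\<le>degree p. coeff p k \<odot> (A ^^ k) v)"

lemma pact_eq:
  assumes "degree p \<le> n"
  shows "pact A p v = (\<Sum>k\<le>n. coeff p k \<odot> (A ^^ k) v)"
  unfolding pact_def
  by (rule sum.mono_neutral_left) (use assms in \<open>auto intro: coeff_eq_0\<close>)

lemma pact_linear_factor:
  assumes "lin A"
  shows "pact A ([:- c, 1:] * q) v = A (pact A q v) - c \<odot> pact A q v"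
proof -
  let ?n = "degree q"
  have "pact A ([:- c, 1:] * q) v = (\<Sum>k\<le>Suc ?n. coeff ([:- c, 1:] * q) k \<odot> (A ^^ k) v)"
    by (rule pact_eq, rule order_trans[OF degree_mult_le]) simp
  also have "\<dots> = (\<Sum>k\<le>Suc ?n. coeff (pCons 0 q) k \<odot> (A ^^ k) v)
      - c \<odot> (\<Sum>k\<le>Suc ?n. coeff q k \<odot> (A ^^ k) v)"
    by (simp add: scale_left_diff_distrib sum_subtractf scale_sum_right scale_right_diff_distrib
        scale_right_distrib del: sum.atMost_Suc)
  also have "(\<Sum>k\<le>Suc ?n. coeff (pCons 0 q) k \<odot> (A ^^ k) v) = A (pact A q v)"
    by (subst sum.atMost_Suc_shift) (simp add: pact_def lin_simps[OF assms])
  also have "(\<Sum>k\<le>Suc ?n. coeff q k \<odot> (A ^^ k) v) = pact A q v"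
    by (rule pact_eq[symmetric]) simp
  finally show ?thesis .
qed

lemma pact_in_subspace:
  assumes "subspace S" "\<And>v. v \<in> S \<Longrightarrow> A v \<in> S" "v \<in> S"
  shows "pact A p v \<in> S"
proof -
  have "(A ^^ k) v \<in> S" for k by (induction k) (use assms in auto)
  then show ?thesis unfolding pact_def by (intro subspace_sum subspace_scale assms)
qed

text \<open>The vectors obtained from \<open>v\<close> by the powers of \<open>A\<close> up to
  \<open>dimension\<close> are too many to be independent; a dependence supplies the coefficients of
  \<open>p\<close>.\<close>

lemma annihilating_poly: "\<exists>p. p \<noteq> 0 \<and> pact A p v = 0"
proof -
  let ?n = "dimension" and ?f = "\<lambda>k. (A ^^ k) v"
  show ?thesis
  proof (cases "inj_on ?f {..?n}")
    case True
    then have "card (?f ` {..?n}) = Suc ?n" by (simp add: card_image)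
    then have "dependent (?f ` {..?n})"
      using independent_card_le_dimension by fastforce
    then obtain u where u: "\<exists>w\<in>?f ` {..?n}. u w \<noteq> 0" "(\<Sum>w\<in>?f ` {..?n}. u w \<odot> w) = 0"
      by (auto simp: dependent_finite)
    define p where "p = (\<Sum>k\<le>?n. monom (u (?f k)) k)"
    have c: "coeff p k = (if k \<le> ?n then u (?f k) else 0)" for k
      by (simp add: p_def coeff_sum)
    have "p \<noteq> 0" using u(1) c by (metis (no_types, lifting) atMost_iff coeff_0 imageE)
    moreover have "pact A p v = (\<Sum>k\<le>?n. coeff p k \<odot> ?f k)"
      by (rule pact_eq) (simp add: c degree_le)
    moreover have "\<dots> = 0"
      using u(2) True by (simp add: c sum.reindex)
    ultimately show ?thesis by metis
  next
    case False
    then obtain j k where jk: "j \<noteq> k" "?f j = ?f k" by (auto simp: inj_on_def)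
    \<comment> \<open>Independence of a set does not see repetitions, so coinciding powers are
      treated apart.\<close>
    define p where "p = monom (1::'a) j - monom 1 k"
    have "coeff p j \<noteq> 0" using jk by (simp add: p_def)
    then have "p \<noteq> 0" by auto
    moreover have "pact A p v = (\<Sum>i\<le>max j k. coeff p i \<odot> ?f i)"
      by (rule pact_eq) (auto simp: p_def intro!: degree_le)
    moreover have "\<dots> = (\<Sum>i\<le>max j k. (if i = j then ?f j else 0) - (if i = k then ?f k else 0))"
      by (intro sum.cong refl) (auto simp: p_def)
    moreover have "\<dots> = 0"
      using jk by (simp add: sum_subtractf)
    ultimately show ?thesis by metis
  qed
qed

text \<open>Split off a linear factor at a root \<open>c\<close>: either the cofactor already
  annihilates \<open>v\<close> and has smaller degree, or it maps \<open>v\<close> to an eigenvector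
  for \<open>c\<close> inside \<open>S\<close>.\<close>

lemma eigenvector_of_annihilating_poly:
  assumes "lin A" "subspace S" "\<And>v. v \<in> S \<Longrightarrow> A v \<in> S"
  shows "p \<noteq> 0 \<Longrightarrow> v \<in> S \<Longrightarrow> v \<noteq> 0 \<Longrightarrow> pact A p v = 0 \<Longrightarrow> \<exists>c. \<exists>w\<in>S. w \<noteq> 0 \<and> A w = c \<odot> w"
proof (induction "degree p" arbitrary: p)
  case 0
  then obtain c where "p = [:c:]" "c \<noteq> 0" by (metis degree_eq_zeroE pCons_0_0)
  then show ?case using 0 by (simp add: pact_def)
next
  case (Suc n)
  then obtain c where "poly p c = 0" using alg_closed_imp_poly_has_root[of p] by auto
  then obtain q where p: "p = [:- c, 1:] * q" by (auto simp: poly_eq_0_iff_dvd elim: dvdE)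
  then have q: "q \<noteq> 0" "degree q = n"
    using Suc by (auto simp: degree_mult_eq simp del: mult_pCons_left)
  show ?case
  proof (cases "pact A q v = 0")
    case True
    then show ?thesis using Suc q by metis
  next
    case False
    moreover have "A (pact A q v) = c \<odot> pact A q v"
      using Suc.prems(4) unfolding p pact_linear_factor[OF assms(1)] by simp
    moreover have "pact A q v \<in> S" by (rule pact_in_subspace) (use assms Suc.prems in auto)
    ultimately show ?thesis by blast
  qed
qed

lemma eigenvector_in_subspace:
  assumes "lin A" "subspace S" "\<And>v. v \<in> S \<Longrightarrow> A v \<in> S" "v \<in> S" "v \<noteq> 0"
  obtains c w where "w \<in> S" "w \<noteq> 0" "A w = c \<odot> w"
  using annihilating_poly[of A v] eigenvector_of_annihilating_poly[OF assms(1-3) _ assms(4,5)]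
  by metis

section \<open>Strings and integrality for sl(2)-triples\<close>

lemma nilpotent_of_shift:
  assumes H: "lin H" and v: "H v = c \<odot> v" and d: "d \<noteq> 0"
    and shift: "\<And>w. H (E w) = E (H w) + d \<odot> E w" and E: "lin E"
  obtains n where "(E ^^ n) v = 0"
proof -
  have ev: "H ((E ^^ k) v) = (c + of_nat k * d) \<odot> (E ^^ k) v" for k
    by (induction k) (simp_all add: v shift lin_simps[OF E] scale_left_distrib algebra_simps)
  have "\<exists>n. (E ^^ n) v = 0"
  proof (rule ccontr)
    assume "\<not> ?thesis"
    \<comment> \<open>The iterates have the pairwise different eigenvalues \<open>c + k * d\<close>,
      so \<open>dimension + 1\<close> nonzero ones would be independent.\<close>
    then have "independent ((\<lambda>k. (E ^^ k) v) ` {..dimension})"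
        "card ((\<lambda>k. (E ^^ k) v) ` {..dimension}) = card {..dimension}"
      using eigenvectors_independent[OF H, of "{..dimension}" "\<lambda>k. c + of_nat k * d"
          "\<lambda>k. (E ^^ k) v"] ev d
      by (auto simp: inj_on_def)
    then show False
      using independent_card_le_dimension by fastforce
  qed
  then show ?thesis using that by blast
qed

text \<open>On the k-th iterate of \<open>F\<close> the eigenvalue of \<open>H\<close> is
  \<open>z - 2 * k\<close>, and \<open>E\<close> leads back to it from the next one with factor
  \<open>c * (k + 1) * (z - k)\<close>. At the first vanishing iterate this factor is 0. The
  constant \<open>c\<close> admits unnormalised root vectors.\<close>

lemma sl2_primitive:
  assumes lin: "lin E" "lin F" "lin H" and c: "c \<noteq> 0"
    and EF: "\<And>w. E (F w) - F (E w) = c \<odot> H w"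
    and HF: "\<And>w. H (F w) = F (H w) - 2 \<odot> F w"
    and u: "E u = 0" "H u = z \<odot> u" "u \<noteq> 0"
  obtains n :: nat where "z = of_nat n"
proof -
  note ls = lin_simps[OF lin(1)] lin_simps[OF lin(2)] lin_simps[OF lin(3)]
  have HFk: "H ((F ^^ k) u) = (z - 2 * of_nat k) \<odot> (F ^^ k) u" for k
  proof (induction k)
    case (Suc k)
    have "H ((F ^^ Suc k) u) = (z - 2 * of_nat k) \<odot> (F ^^ Suc k) u - 2 \<odot> (F ^^ Suc k) u"
      by (simp add: HF Suc ls)
    also have "\<dots> = (z - 2 * of_nat (Suc k)) \<odot> (F ^^ Suc k) u"
      by (simp only: scale_left_diff_distrib[symmetric]) (simp add: algebra_simps)
    finally show ?case .
  qed (simp add: u)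
  have EFk: "E ((F ^^ Suc k) u) = (c * (of_nat (Suc k) * (z - of_nat k))) \<odot> (F ^^ k) u" for k
  proof (induction k)
    case 0
    show ?case using EF[of u] by (simp add: u ls)
  next
    case (Suc k)
    have "E ((F ^^ Suc (Suc k)) u) = F (E ((F ^^ Suc k) u)) + c \<odot> H ((F ^^ Suc k) u)"
      using EF[of "(F ^^ Suc k) u"] by (simp add: algebra_simps)
    also have "\<dots> = (c * (of_nat (Suc k) * (z - of_nat k))) \<odot> (F ^^ Suc k) u
        + (c * (z - 2 * of_nat (Suc k))) \<odot> (F ^^ Suc k) u"
      unfolding Suc HFk by (simp add: ls)
    also have "\<dots> = (c * (of_nat (Suc (Suc k)) * (z - of_nat (Suc k)))) \<odot> (F ^^ Suc k) u"
      unfolding scale_left_distrib[symmetric] by (rule arg_cong[where f = "\<lambda>a. a \<odot> _"])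
        (simp add: algebra_simps)
    finally show ?case .
  qed
  obtain n where n: "(F ^^ n) u = 0"
    by (rule nilpotent_of_shift[OF lin(3) u(2), of "-2" F]) (simp_all add: HF lin(2) scale_minus_left)
  define m where "m = (LEAST n. (F ^^ n) u = 0)"
  have m: "(F ^^ m) u = 0" unfolding m_def by (rule LeastI[of _ n], rule n)
  then have "m \<noteq> 0" using u(3) by (metis funpow_0)
  then obtain k where k: "m = Suc k" by (cases m) auto
  have "(F ^^ k) u \<noteq> 0" using not_less_Least[of k "\<lambda>n. (F ^^ n) u = 0"] k m_def by simp
  then have "z = of_nat k" using EFk[of k] m k ls(4) c
    by (simp del: of_nat_Suc funpow.simps)
  then show ?thesis by (rule that)
qed

text \<open>The last nonzero iterate of \<open>E\<close> on \<open>v\<close> is primitive, which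
  makes \<open>z\<close> an integer. The second conclusion is what later produces new weights from
  known ones.\<close>

lemma sl2_weight:
  assumes lin: "lin E" "lin F" "lin H" and c: "c \<noteq> 0"
    and EF: "\<And>w. E (F w) - F (E w) = c \<odot> H w"
    and HE: "\<And>w. H (E w) = E (H w) + 2 \<odot> E w"
    and HF: "\<And>w. H (F w) = F (H w) - 2 \<odot> F w"
    and v: "H v = z \<odot> v" "v \<noteq> 0"
  obtains n :: int where "z = of_int n" "n > 0 \<Longrightarrow> F v \<noteq> 0"
proof -
  note ls = lin_simps[OF lin(1)] lin_simps[OF lin(2)] lin_simps[OF lin(3)]
  have HEk: "H ((E ^^ k) v) = (z + 2 * of_nat k) \<odot> (E ^^ k) v" for k
  proof (induction k)
    case (Suc k)
    have "H ((E ^^ Suc k) v) = (z + 2 * of_nat k) \<odot> (E ^^ Suc k) v + 2 \<odot> (E ^^ Suc k) v"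
      by (simp add: HE Suc ls)
    also have "\<dots> = (z + 2 * of_nat (Suc k)) \<odot> (E ^^ Suc k) v"
      by (simp only: scale_left_distrib[symmetric]) (simp add: algebra_simps)
    finally show ?case .
  qed (simp add: v)
  obtain n where n: "(E ^^ n) v = 0"
    by (rule nilpotent_of_shift[OF lin(3) v(1) _ HE lin(1)]) auto
  define m where "m = (LEAST n. (E ^^ n) v = 0)"
  have m: "(E ^^ m) v = 0" unfolding m_def by (rule LeastI[of _ n], rule n)
  then have "m \<noteq> 0" using v(2) by (metis funpow_0)
  then obtain k where k: "m = Suc k" by (cases m) auto
  have nz: "(E ^^ k) v \<noteq> 0" using not_less_Least[of k "\<lambda>n. (E ^^ n) v = 0"] k m_def by simp
  obtain l where l: "z + 2 * of_nat k = of_nat l"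
    by (rule sl2_primitive[OF lin c EF HF, of "(E ^^ k) v" "z + 2 * of_nat k"])
      (use m k nz HEk in auto)
  then have z: "z = of_int (int l - 2 * int k)" by (simp add: algebra_simps)
  moreover have "F v \<noteq> 0" if pos: "int l - 2 * int k > 0"
  proof
    assume F: "F v = 0"
    \<comment> \<open>If \<open>F v = 0\<close>, then \<open>v\<close> is primitive for the reversed
      triple \<open>F\<close>, \<open>E\<close>, \<open>- H\<close>, so \<open>- z\<close> would be
      natural too.\<close>
    obtain i where "- z = of_nat i"
    proof (rule sl2_primitive[OF lin(2,1), of "\<lambda>w. - H w" c v "- z"])
      show "lin (\<lambda>w. - H w)" by (rule linI) (simp_all add: ls)
      show "F (E w) - E (F w) = c \<odot> - H w" for w
        using EF[of w] by (simp add: algebra_simps)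
    qed (use F v c HE in \<open>simp_all add: ls scale_minus_left\<close>)
    then have "of_int (int l - 2 * int k + int i) = (0::'a)"
      using z by (metis add.right_inverse of_int_add of_int_of_nat_eq)
    then show False using pos unfolding of_int_eq_0_iff by linarith
  qed
  ultimately show ?thesis by (rule that)
qed

end


section \<open>Weights of eight-dimensional representations of \<open>so\<^sub>8\<close>\<close>

lemma exhaust_8: "(i::8) = 0 \<or> i = 1 \<or> i = 2 \<or> i = 3 \<or> i = 4 \<or> i = 5 \<or> i = 6 \<or> i = 7"
proof (induct i)
  case (of_int z)
  then have "z = 0 \<or> z = 1 \<or> z = 2 \<or> z = 3 \<or> z = 4 \<or> z = 5 \<or> z = 6 \<or> z = 7" by fastforce
  then show ?case by auto
qed

text \<open>The relations are those of the infinitesimal rotations \<open>E_pq - E_qp\<close> of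
  so(8); the square root \<open>im\<close> of -1 serves to diagonalise them.\<close>

locale so8_irrep = ac_vector_space sc Basis
  for sc :: "'a::{alg_closed_field, field_char_0} \<Rightarrow> 'w::ab_group_add \<Rightarrow> 'w" (infixr "\<odot>" 75)
    and Basis :: "'w set" +
  fixes im :: 'a and X :: "8 \<Rightarrow> 8 \<Rightarrow> 'w \<Rightarrow> 'w"
  assumes im_im: "im * im = - 1"
    and linear_X: "lin (X p q)"
    and X_anti: "X q p w = - X p q w"
    and X_bracket: "distinct [p, q, r] \<Longrightarrow> X p q (X q r w) = X q r (X p q w) + X p r w"
    and X_commute: "distinct [p, q, r, s] \<Longrightarrow> X p q (X r s w) = X r s (X p q w)"
    and dimension_8: "dimension = 8"
    and irreducible: "subspace U \<Longrightarrow> (\<And>p q u. u \<in> U \<Longrightarrow> X p q u \<in> U) \<Longrightarrow> U = {0} \<or> U = UNIV"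
begin

lemmas X_lin = lin_simps[OF linear_X]

lemma im_im_mult: "im * (im * z) = - z"
  by (metis im_im mult.assoc mult_minus1)

lemma scale_2: "2 \<odot> w = w + w"
  by (metis one_add_one scale_left_distrib scale_one)

text \<open>The factor \<open>im\<close> turns the eigenvalues of the Cartan rotations into the
  half-integers found below.\<close>

definition ev :: "8 \<Rightarrow> 8 \<Rightarrow> 'a \<Rightarrow> 'w \<Rightarrow> bool" where
  "ev p q a v \<longleftrightarrow> im \<odot> X p q v = a \<odot> v"

lemma evD: "ev p q a v \<Longrightarrow> X p q v = (- im * a) \<odot> v"
  unfolding ev_def
  by (metis (no_types, lifting) im_im mult_minus_left minus_minus scale_one scale_scale)

lemma ev_flip: "ev q p (- a) v \<longleftrightarrow> ev p q a v"
  by (simp add: ev_def X_anti[of q p] scale_minus_left)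

lemma ev_flipI: "ev p q a v \<Longrightarrow> ev q p (- a) v"
  by (simp add: ev_flip)

text \<open>
  The root vectors for \<open>\<plusminus>(\<epsilon>\<^sub>p\<^sub>q + \<epsilon>\<^sub>r\<^sub>s)\<close>, namely \<open>(\<plusminus>im e\<^sub>p + e\<^sub>q) \<and> (\<plusminus>im e\<^sub>r + e\<^sub>s)\<close>.  The other roots on
  the same two planes result from swapping \<open>p, q\<close> or \<open>r, s\<close>.
\<close>

definition lower :: "8 \<Rightarrow> 8 \<Rightarrow> 8 \<Rightarrow> 8 \<Rightarrow> 'w \<Rightarrow> 'w" where
  "lower p q r s w = X q s w - X p r w - im \<odot> (X p s w + X q r w)"

definition raise :: "8 \<Rightarrow> 8 \<Rightarrow> 8 \<Rightarrow> 8 \<Rightarrow> 'w \<Rightarrow> 'w" where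
  "raise p q r s w = X q s w - X p r w + im \<odot> (X p s w + X q r w)"

text \<open>Coroot of the root \<open>eps_pq + eps_rs\<close>: its value on a joint eigenvector is
  the sum of the two eigenvalues. Together with \<open>raise\<close> and \<open>lower\<close> it
  forms an sl(2)-triple up to the constant -4.\<close>

definition coroot :: "8 \<Rightarrow> 8 \<Rightarrow> 8 \<Rightarrow> 8 \<Rightarrow> 'w \<Rightarrow> 'w" where
  "coroot p q r s w = im \<odot> (X p q w + X r s w)"

lemma linear_lower: "lin (lower p q r s)" and linear_raise: "lin (raise p q r s)"
  and linear_coroot: "lin (coroot p q r s)"
  by (rule linI; simp add: lower_def raise_def coroot_def X_lin algebra_simps)+

section \<open>Root vectors, their brackets and the shifts of weights\<close>

context
  fixes p q r s :: 8 assumes d: "distinct [p, q, r, s]"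
begin

lemma X_shift_first:
  "X p q (X q s w) = X q s (X p q w) + X p s w"
  "X p q (X p r w) = X p r (X p q w) - X q r w"
  "X p q (X p s w) = X p s (X p q w) - X q s w"
  "X p q (X q r w) = X q r (X p q w) + X p r w"
  using X_bracket[of p q s w] X_bracket[of q p r w] X_bracket[of q p s w] X_bracket[of p q r w] d
  by (auto simp: X_anti[of q p] X_lin algebra_simps)

lemma X_shift_second:
  "X r s (X q s w) = X q s (X r s w) + X q r w"
  "X r s (X p r w) = X p r (X r s w) - X p s w"
  "X r s (X p s w) = X p s (X r s w) + X p r w"
  "X r s (X q r w) = X q r (X r s w) - X q s w"
  using X_bracket[of q s r w] X_bracket[of p r s w] X_bracket[of p s r w] X_bracket[of q r s w] d
  by (auto simp: X_anti[of s r] X_lin algebra_simps)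

lemma X_lower_first: "im \<odot> X p q (lower p q r s w) = lower p q r s (im \<odot> X p q w) - lower p q r s w"
  by (simp add: lower_def X_lin X_shift_first algebra_simps im_im im_im_mult)

lemma X_lower_second: "im \<odot> X r s (lower p q r s w) = lower p q r s (im \<odot> X r s w) - lower p q r s w"
  by (simp add: lower_def X_lin X_shift_second algebra_simps im_im im_im_mult)

lemma X_raise_first: "im \<odot> X p q (raise p q r s w) = raise p q r s (im \<odot> X p q w) + raise p q r s w"
  by (simp add: raise_def X_lin X_shift_first algebra_simps im_im im_im_mult)

lemma X_raise_second: "im \<odot> X r s (raise p q r s w) = raise p q r s (im \<odot> X r s w) + raise p q r s w"
  by (simp add: raise_def X_lin X_shift_second algebra_simps im_im im_im_mult)

lemma raise_lower: "raise p q r s (lower p q r s w) - lower p q r s (raise p q r s w)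
    = (- 4) \<odot> coroot p q r s w"
proof -
  have "X q s (X p s w) = X p s (X q s w) + X p q w" "X q s (X q r w) = X q r (X q s w) + X r s w"
    "X p r (X p s w) = X p s (X p r w) - X r s w" "X p r (X q r w) = X q r (X p r w) - X p q w"
    using X_bracket[of q s p w] X_bracket[of s q r w] X_bracket[of r p s w] X_bracket[of p r q w] d
    by (auto simp: X_anti[of q p] X_anti[of s p] X_anti[of s q] X_anti[of s r] X_anti[of r p]
        X_anti[of r q] X_lin algebra_simps)
  note br = this
  have "raise p q r s (lower p q r s w) - lower p q r s (raise p q r s w)
      = - (2 \<odot> 2 \<odot> im \<odot> (X p q w + X r s w))"
    by (simp add: br raise_def lower_def X_lin algebra_simps im_im im_im_mult scale_2 del: scale_scale)
  then show ?thesis by (simp add: coroot_def scale_minus_left)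
qed

lemma ev_lower:
  "ev p q a v \<Longrightarrow> ev p q (a - 1) (lower p q r s v)"
  "ev r s b v \<Longrightarrow> ev r s (b - 1) (lower p q r s v)"
  "distinct [p, q, r, s, t, u] \<Longrightarrow> ev t u c v \<Longrightarrow> ev t u c (lower p q r s v)"
proof -
  show "ev p q a v \<Longrightarrow> ev p q (a - 1) (lower p q r s v)"
    "ev r s b v \<Longrightarrow> ev r s (b - 1) (lower p q r s v)"
    by (simp_all add: ev_def X_lower_first X_lower_second lin_simps(5)[OF linear_lower]
        scale_left_diff_distrib)
  assume tu: "distinct [p, q, r, s, t, u]" "ev t u c v"
  have "ev t u c (X g h v)" if "distinct [t, u, g, h]" for g h
    using tu(2) X_commute[OF that] by (simp add: ev_def flip: X_lin(5))
  then have "ev t u c (X q s v)" "ev t u c (X p r v)" "ev t u c (X p s v)" "ev t u c (X q r v)"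
    using tu(1) by auto
  then show "ev t u c (lower p q r s v)"
    by (simp add: ev_def lower_def X_lin scale_right_distrib scale_right_diff_distrib
        scale_left_commute[of im] del: scale_scale)
qed

lemma root_weight:
  assumes "ev p q a v" "ev r s b v" "v \<noteq> 0"
  obtains n :: int where "a + b = of_int n" "n > 0 \<Longrightarrow> lower p q r s v \<noteq> 0"
proof (rule sl2_weight[OF linear_raise linear_lower linear_coroot _ raise_lower])
  show "coroot p q r s (raise p q r s w) = raise p q r s (coroot p q r s w) + 2 \<odot> raise p q r s w" for w
    using X_raise_first[of w] X_raise_second[of w]
    by (simp add: coroot_def lin_simps[OF linear_raise] scale_right_distrib scale_2)
  show "coroot p q r s (lower p q r s w) = lower p q r s (coroot p q r s w) - 2 \<odot> lower p q r s w" for w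
    using X_lower_first[of w] X_lower_second[of w]
    by (simp add: coroot_def lin_simps[OF linear_lower] scale_right_distrib scale_2)
  show "coroot p q r s v = (a + b) \<odot> v"
    using assms by (simp add: ev_def coroot_def scale_right_distrib scale_left_distrib)
qed (use assms that in auto)

end

text \<open>Swapping \<open>p, q\<close> or \<open>r, s\<close> gives the root vectors of all four
  roots on the two planes. Their span contains the four rotations that mix the planes, because 2 and
  \<open>im\<close> are invertible.\<close>

lemma lower_all_zero:
  assumes "lower p q r s v = 0" "lower p q s r v = 0" "lower q p r s v = 0" "lower q p s r v = 0"
  shows "X p r v = 0" "X p s v = 0" "X q r v = 0" "X q s v = 0"
proof -
  have im: "im \<noteq> 0" using im_im by auto
  have half: "w + w = 0 \<Longrightarrow> w = 0" for w :: 'w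
    unfolding scale_2[symmetric] by simp
  let ?a = "X p r v" and ?b = "X p s v" and ?c = "X q r v" and ?d = "X q s v"
  define x where "x = im \<odot> (?a + ?d)"
  define y where "y = im \<odot> (?b + ?c)"
  have e: "?d - ?a - y = 0" "?c - ?b - x = 0" "?b - ?c - x = 0" "?a - ?d - y = 0"
    using assms unfolding lower_def x_def y_def by (simp_all only: add.commute)
  have "x + x = - (?c - ?b - x) - (?b - ?c - x)" "y + y = - (?d - ?a - y) - (?a - ?d - y)"
    by simp_all
  then have "x + x = 0" "y + y = 0" unfolding e by simp_all
  then have xy: "x = 0" "y = 0" using half[of x] half[of y] by blast+
  then have s: "?b + ?c = 0" "?a + ?d = 0"
    using im by (simp_all add: x_def y_def)
  then have "?d = ?a" "?c = ?b" using e(1,2) xy by simp_all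
  moreover from this s have "?a + ?a = 0" "?b + ?b = 0" by simp_all
  then have "?a = 0" "?b = 0" using half[of ?a] half[of ?b] by blast+
  ultimately show "?a = 0" "?b = 0" "?c = 0" "?d = 0" by simp_all
qed

text \<open>The four disjoint planes are those rotated by \<open>V g_1\<close>, see
  \<open>elt_cartan\<close>. The planes are ordered so that sums and differences of
  \<open>a, b\<close> and of \<open>c, d\<close> are the four orthogonal roots.\<close>

definition weight_vector :: "'a \<Rightarrow> 'a \<Rightarrow> 'a \<Rightarrow> 'a \<Rightarrow> 'w \<Rightarrow> bool" where
  "weight_vector a b c d v \<longleftrightarrow> v \<noteq> 0 \<and> ev 4 2 a v \<and> ev 1 0 b v \<and> ev 7 3 c v \<and> ev 6 5 d v"

text \<open>Rotations in disjoint planes commute, so each operator preserves the joint eigenspaces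
  of the previous ones, and an eigenvector is found inside them plane by plane.\<close>

lemma weight_vector_exists: obtains a b c d v where "weight_vector a b c d v"
proof -
  have sub: "subspace {v. ev p q a v}" for p q a
  proof -
    have "im \<odot> X p q (c \<odot> x) = a \<odot> c \<odot> x" if "im \<odot> X p q x = a \<odot> x" for c x
      by (simp only: X_lin scale_left_commute[of im c] scale_left_commute[of a c] that)
    then show ?thesis by (auto simp: subspace_def ev_def X_lin scale_right_distrib)
  qed
  have inv: "ev p q a v \<Longrightarrow> distinct [p, q, r, s] \<Longrightarrow> ev p q a (im \<odot> X r s v)" for p q r s a v
  proof -
    assume *: "ev p q a v" "distinct [p, q, r, s]"
    have "im \<odot> X p q (im \<odot> X r s v) = im \<odot> X r s (im \<odot> X p q v)"
      by (simp only: X_lin X_commute[OF *(2)])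
    also have "\<dots> = a \<odot> im \<odot> X r s v"
      using *(1) by (simp add: ev_def X_lin mult.commute)
    finally show "ev p q a (im \<odot> X r s v)" by (simp add: ev_def)
  qed
  have linJ: "lin (\<lambda>v. im \<odot> X p q v)" for p q
    by (rule linI) (simp_all add: X_lin scale_right_distrib mult.commute)
  obtain z where "z \<in> Basis" using dimension_8 by (fastforce simp: dimension_def)
  then have z: "z \<noteq> 0" using independent_Basis dependent_zero by metis
  have ex: "\<exists>a w. w \<noteq> 0 \<and> w \<in> S \<and> ev p q a w"
    if "subspace S" "v \<in> S" "v \<noteq> 0" "\<And>v. v \<in> S \<Longrightarrow> im \<odot> X p q v \<in> S" for p q S v
    unfolding ev_def by (rule eigenvector_in_subspace[OF linJ that(1,4,2,3)]) auto
  note sub2 = subspace_inter[OF sub[of 4 2] sub[of 1 0]]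
  note sub3 = subspace_inter[OF sub2 sub[of 7 3]]
  obtain a va where a: "va \<noteq> 0" "ev 4 2 a va"
    using ex[of UNIV z 4 2] z by auto
  obtain b vb where b: "vb \<noteq> 0" "ev 4 2 a vb" "ev 1 0 b vb"
    using ex[OF sub[of 4 2 a], of va 1 0] a inv[of 4 2 a _ 1 0] by auto
  obtain c vc where c: "vc \<noteq> 0" "ev 4 2 a vc" "ev 1 0 b vc" "ev 7 3 c vc"
    using ex[OF sub2[of a b], of vb 7 3] b inv[of 4 2 a _ 7 3] inv[of 1 0 b _ 7 3] by auto
  obtain d v where "v \<noteq> 0" "ev 4 2 a v" "ev 1 0 b v" "ev 7 3 c v" "ev 6 5 d v"
    using ex[OF sub3[of a b c], of vc 6 5] c inv[of 4 2 a _ 6 5] inv[of 1 0 b _ 6 5]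
      inv[of 7 3 c _ 6 5] by auto
  then show ?thesis using that[of a b c d v] by (simp add: weight_vector_def)
qed


text \<open>Were 0 the only weight, root vectors would send a vector of weight 0 to nonzero weights,
  hence to 0. All rotations would then annihilate it, and its span would be an invariant line in
  dimension 8.\<close>

lemma nonzero_weight_exists:
  obtains a b c d v where "weight_vector a b c d v" "\<not> (a = 0 \<and> b = 0 \<and> c = 0 \<and> d = 0)"
proof (rule ccontr)
  assume "\<not> thesis"
  then have N: "ev 4 2 a w \<Longrightarrow> ev 1 0 b w \<Longrightarrow> ev 7 3 c w \<Longrightarrow> ev 6 5 d w \<Longrightarrow>
    w = 0 \<or> (a = 0 \<and> b = 0 \<and> c = 0 \<and> d = 0)" for a b c d w
    using that[of a b c d w] by (auto simp: weight_vector_def)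
  obtain a b c d v where "weight_vector a b c d v" by (rule weight_vector_exists)
  then have v: "v \<noteq> 0" "ev 4 2 0 v" "ev 1 0 0 v" "ev 7 3 0 v" "ev 6 5 0 v"
    using N[of a v b c d] by (auto simp: weight_vector_def)
  have ev0: "ev q p 0 w \<longleftrightarrow> ev p q 0 w" for p q w using ev_flip[of q p 0 w] by simp
  have ev1: "ev q p (- 1) w \<longleftrightarrow> ev p q 1 w" for p q w by (rule ev_flip)
  \<comment> \<open>The assumption \<open>n\<close> excludes eigenvalue 1 or -1 on the first plane,
    so the four root vectors vanish on \<open>v\<close>, and with them the mixed rotations.\<close>
  have X0: "X p r v = 0" "X p s v = 0" "X q r v = 0" "X q s v = 0"
    if d: "distinct [p, q, r, s, t, u, x, y]"
      and e: "ev p q 0 v" "ev r s 0 v" "ev t u 0 v" "ev x y 0 v"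
      and n: "\<And>a b w. ev p q a w \<Longrightarrow> ev r s b w \<Longrightarrow> ev t u 0 w \<Longrightarrow> ev x y 0 w \<Longrightarrow> w = 0 \<or> a = 0"
    for p q r s t u x y
  proof -
    have L: "ev p q (- 1) (lower p q r s v)" "ev r s (- 1) (lower p q r s v)"
      "ev t u 0 (lower p q r s v)" "ev x y 0 (lower p q r s v)"
      if "ev p q 0 v" "ev r s 0 v" "distinct [p, q, r, s, t, u, x, y]" for p q r s
      using ev_lower(1)[of p q r s 0] ev_lower(2)[of p q r s 0] ev_lower(3)[of p q r s t u 0]
        ev_lower(3)[of p q r s x y 0] that e by auto
    have m: "ev p q 1 w \<Longrightarrow> ev r s b w \<Longrightarrow> ev t u 0 w \<Longrightarrow> ev x y 0 w \<Longrightarrow> w = 0"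
        "ev p q (- 1) w \<Longrightarrow> ev r s b w \<Longrightarrow> ev t u 0 w \<Longrightarrow> ev x y 0 w \<Longrightarrow> w = 0" for w b
      using n[of 1 w b] n[of "-1" w b] by auto
    have "lower p q r s v = 0" using L[of p q r s] d e by (intro m(2)) auto
    moreover have "lower p q s r v = 0"
      using L[of p q s r] d e ev0[of r s] ev1[of s r]
      by (intro m(2)[of _ 1]) auto
    moreover have "lower q p r s v = 0"
      using L[of q p r s] d e ev0[of p q] ev1[of q p] by (intro m(1)) auto
    moreover have "lower q p s r v = 0"
      using L[of q p s r] d e ev0[of p q] ev1[of q p] ev0[of r s] ev1[of s r]
      by (intro m(1)[of _ 1]) auto
    ultimately show "X p r v = 0" "X p s v = 0" "X q r v = 0" "X q s v = 0"
      by (rule lower_all_zero)+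
  qed
  have H: "X 4 2 v = 0" "X 1 0 v = 0" "X 7 3 v = 0" "X 6 5 v = 0"
    using v(2-5)[THEN evD] by simp_all
  \<comment> \<open>The six pairs of planes account for all rotations outside the Cartan
    subalgebra.\<close>
  have 1: "X 4 1 v = 0 \<and> X 4 0 v = 0 \<and> X 2 1 v = 0 \<and> X 2 0 v = 0"
    using N v(2-5) by (intro conjI X0[of 4 2 1 0 7 3 6 5]; (assumption | blast | simp; fail))
  have 2: "X 4 7 v = 0 \<and> X 4 3 v = 0 \<and> X 2 7 v = 0 \<and> X 2 3 v = 0"
    using N v(2-5) by (intro conjI X0[of 4 2 7 3 1 0 6 5]; (assumption | blast | simp; fail))
  have 3: "X 4 6 v = 0 \<and> X 4 5 v = 0 \<and> X 2 6 v = 0 \<and> X 2 5 v = 0"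
    using N v(2-5) by (intro conjI X0[of 4 2 6 5 1 0 7 3]; (assumption | blast | simp; fail))
  have 4: "X 1 7 v = 0 \<and> X 1 3 v = 0 \<and> X 0 7 v = 0 \<and> X 0 3 v = 0"
    using N v(2-5) by (intro conjI X0[of 1 0 7 3 4 2 6 5]; (assumption | blast | simp; fail))
  have 5: "X 1 6 v = 0 \<and> X 1 5 v = 0 \<and> X 0 6 v = 0 \<and> X 0 5 v = 0"
    using N v(2-5) by (intro conjI X0[of 1 0 6 5 4 2 7 3]; (assumption | blast | simp; fail))
  have 6: "X 7 6 v = 0 \<and> X 7 5 v = 0 \<and> X 3 6 v = 0 \<and> X 3 5 v = 0"
    using N v(2-5) by (intro conjI X0[of 7 3 6 5 1 0 4 2]; (assumption | blast | simp; fail))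
  have *: "X q p v = 0 \<longleftrightarrow> X p q v = 0" for p q using X_anti[of q p v] by simp
  have diag: "X p p v = 0" for p
  proof -
    have "2 \<odot> X p p v = 0" unfolding scale_2 by (subst X_anti) simp
    then show ?thesis by simp
  qed
  have all: "X p q v = 0" for p q
    using exhaust_8[of p] exhaust_8[of q] H 1 2 3 4 5 6 diag *
    by (elim disjE) simp_all
  have "span {v} = {0} \<or> span {v} = UNIV"
  proof (rule irreducible)
    show "subspace (span {v})" by (rule subspace_span)
    show "u \<in> span {v} \<Longrightarrow> X p q u \<in> span {v}" for p q u
      by (auto simp: span_singleton X_lin all)
  qed
  moreover have "v \<in> span {v}" by (rule span_base) simp
  ultimately have "span {v} = UNIV" using v(1) by auto
  then have "dim UNIV \<le> card {v}" by (intro dim_le_card) auto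
  then show False using dimension_8 by (simp add: dim_UNIV dimension_def)
qed


text \<open>The roots used are the four orthogonal ones, read from \<open>a + b\<close>,
  \<open>a - b\<close>, \<open>c + d\<close>, \<open>c - d\<close>, together with
  \<open>a + c\<close>, which links the two halves, and the negatives of all five. The sign of the
  coroot tells which root vector does not kill \<open>v\<close>.\<close>

lemma weight_vector_lower:
  assumes "weight_vector a b c d v"
  shows "a + b = of_int n \<Longrightarrow> n > 0 \<Longrightarrow> \<exists>w. weight_vector (a - 1) (b - 1) c d w"
    "a + b = of_int n \<Longrightarrow> n < 0 \<Longrightarrow> \<exists>w. weight_vector (a + 1) (b + 1) c d w"
    "a - b = of_int n \<Longrightarrow> n > 0 \<Longrightarrow> \<exists>w. weight_vector (a - 1) (b + 1) c d w"
    "a - b = of_int n \<Longrightarrow> n < 0 \<Longrightarrow> \<exists>w. weight_vector (a + 1) (b - 1) c d w"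
    "c + d = of_int n \<Longrightarrow> n > 0 \<Longrightarrow> \<exists>w. weight_vector a b (c - 1) (d - 1) w"
    "c + d = of_int n \<Longrightarrow> n < 0 \<Longrightarrow> \<exists>w. weight_vector a b (c + 1) (d + 1) w"
    "c - d = of_int n \<Longrightarrow> n > 0 \<Longrightarrow> \<exists>w. weight_vector a b (c - 1) (d + 1) w"
    "c - d = of_int n \<Longrightarrow> n < 0 \<Longrightarrow> \<exists>w. weight_vector a b (c + 1) (d - 1) w"
    "a + c = of_int n \<Longrightarrow> n > 0 \<Longrightarrow> \<exists>w. weight_vector (a - 1) b (c - 1) d w"
    "a + c = of_int n \<Longrightarrow> n < 0 \<Longrightarrow> \<exists>w. weight_vector (a + 1) b (c + 1) d w"
proof -
  have v: "v \<noteq> 0" "ev 4 2 a v" "ev 1 0 b v" "ev 7 3 c v" "ev 6 5 d v"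
    using assms by (simp_all add: weight_vector_def)
  have step: "\<exists>w. w \<noteq> 0 \<and> ev p q (a - 1) w \<and> ev r s (b - 1) w \<and> ev t u c w \<and> ev x y d w"
    \<comment> \<open>One form of root suffices: reversing a plane negates its eigenvalue, and
      planes can be permuted.\<close>
    if "distinct [p, q, r, s, t, u, x, y]" "ev p q a v" "ev r s b v" "ev t u c v" "ev x y d v"
      "a + b = of_int n" "n > 0" for p q r s t u x y a b c d n
  proof -
    have d: "distinct [p, q, r, s]" using that(1) by auto
    note e = that(2,3)
    obtain m :: int where m: "a + b = of_int m" "m > 0 \<Longrightarrow> lower p q r s v \<noteq> 0"
      using root_weight[OF d e v(1)] by blast
    then have "lower p q r s v \<noteq> 0" using that(6,7) by simp
    moreover have "distinct [p, q, r, s, t, u]" "distinct [p, q, r, s, x, y]" using that(1) by auto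
    ultimately show ?thesis using ev_lower[OF d] that by blast
  qed
  have flip: "ev p q (- a - 1) w \<longleftrightarrow> ev q p (a + 1) w" for p q a w
  proof -
    have "- a - 1 = - (a + 1)" by simp
    then show ?thesis by (simp only: ev_flip)
  qed
  have m: "- a - b = - of_int n \<longleftrightarrow> a + b = (of_int n :: 'a)" for a b n
    by (metis minus_add_distrib neg_equal_iff_equal add_uminus_conv_diff)
  have m': "b - a = - of_int n \<longleftrightarrow> a - b = (of_int n :: 'a)" for a b n
    by (metis minus_diff_eq neg_equal_iff_equal)
  note f = v(2-5)[THEN ev_flipI]
  show "a + b = of_int n \<Longrightarrow> n > 0 \<Longrightarrow> \<exists>w. weight_vector (a - 1) (b - 1) c d w"
    unfolding weight_vector_def using step[OF _ v(2,3,4,5), of n] by simp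
  show "a + b = of_int n \<Longrightarrow> n < 0 \<Longrightarrow> \<exists>w. weight_vector (a + 1) (b + 1) c d w"
    unfolding weight_vector_def using step[OF _ f(1,2) v(4,5), of "- n"] by (simp add: flip m)
  show "a - b = of_int n \<Longrightarrow> n > 0 \<Longrightarrow> \<exists>w. weight_vector (a - 1) (b + 1) c d w"
    unfolding weight_vector_def using step[OF _ v(2) f(2) v(4,5), of "n"] by (simp add: flip)
  show "a - b = of_int n \<Longrightarrow> n < 0 \<Longrightarrow> \<exists>w. weight_vector (a + 1) (b - 1) c d w"
    unfolding weight_vector_def using step[OF _ f(1) v(3) v(4,5), of "- n"]
    by (simp add: flip m')
  show "c + d = of_int n \<Longrightarrow> n > 0 \<Longrightarrow> \<exists>w. weight_vector a b (c - 1) (d - 1) w"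
    unfolding weight_vector_def using step[OF _ v(4,5,2,3), of n] by (simp add: conj_ac)
  show "c + d = of_int n \<Longrightarrow> n < 0 \<Longrightarrow> \<exists>w. weight_vector a b (c + 1) (d + 1) w"
    unfolding weight_vector_def using step[OF _ f(3,4) v(2,3), of "- n"] by (simp add: flip m conj_ac)
  show "c - d = of_int n \<Longrightarrow> n > 0 \<Longrightarrow> \<exists>w. weight_vector a b (c - 1) (d + 1) w"
    unfolding weight_vector_def using step[OF _ v(4) f(4) v(2,3), of "n"] by (simp add: flip conj_ac)
  show "c - d = of_int n \<Longrightarrow> n < 0 \<Longrightarrow> \<exists>w. weight_vector a b (c + 1) (d - 1) w"
    unfolding weight_vector_def using step[OF _ f(3) v(5) v(2,3), of "- n"]
    by (simp add: flip m' conj_ac)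
  show "a + c = of_int n \<Longrightarrow> n > 0 \<Longrightarrow> \<exists>w. weight_vector (a - 1) b (c - 1) d w"
    unfolding weight_vector_def using step[OF _ v(2,4,3,5), of n] by (simp add: conj_ac)
  show "a + c = of_int n \<Longrightarrow> n < 0 \<Longrightarrow> \<exists>w. weight_vector (a + 1) b (c + 1) d w"
    unfolding weight_vector_def using step[OF _ f(1,3) v(3,5), of "- n"] by (simp add: flip m conj_ac)
qed

section \<open>Integral coordinates of weights and moves between weights\<close>

text \<open>In the coordinates \<open>m\<^sub>1, \<dots>, m\<^sub>4\<close> on the four orthogonal roots the coroots act by integers, and
  the remaining roots become \<open>(\<plusminus>1, \<plusminus>1, \<plusminus>1, \<plusminus>1)\<close>.\<close>

definition is_weight :: "int \<Rightarrow> int \<Rightarrow> int \<Rightarrow> int \<Rightarrow> 'w \<Rightarrow> bool" where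
  "is_weight m1 m2 m3 m4 v \<longleftrightarrow> weight_vector (of_int (m1 + m2) / 2) (of_int (m1 - m2) / 2)
     (of_int (m3 + m4) / 2) (of_int (m3 - m4) / 2) v"

definition weights :: "int \<Rightarrow> int \<Rightarrow> int \<Rightarrow> int \<Rightarrow> bool" where
  "weights m1 m2 m3 m4 \<longleftrightarrow> (\<exists>v. is_weight m1 m2 m3 m4 v)"

text \<open>With \<open>m1 = a + b\<close>, \<open>m2 = a - b\<close>, \<open>m3 = c + d\<close>,
  \<open>m4 = c - d\<close> an orthogonal root moves one coordinate by 2, and the root of
  \<open>a + c\<close> moves all four by 1. The integer \<open>n\<close> is the value of
  \<open>a + c\<close>.\<close>

lemma weights_step:
  assumes "weights m1 m2 m3 m4"
  shows "m1 > 0 \<Longrightarrow> weights (m1 - 2) m2 m3 m4" "m1 < 0 \<Longrightarrow> weights (m1 + 2) m2 m3 m4"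
    "m2 > 0 \<Longrightarrow> weights m1 (m2 - 2) m3 m4" "m2 < 0 \<Longrightarrow> weights m1 (m2 + 2) m3 m4"
    "m3 > 0 \<Longrightarrow> weights m1 m2 (m3 - 2) m4" "m3 < 0 \<Longrightarrow> weights m1 m2 (m3 + 2) m4"
    "m4 > 0 \<Longrightarrow> weights m1 m2 m3 (m4 - 2)" "m4 < 0 \<Longrightarrow> weights m1 m2 m3 (m4 + 2)"
    "m1 + m2 + m3 + m4 = 2 * n \<Longrightarrow> n > 0 \<Longrightarrow> weights (m1 - 1) (m2 - 1) (m3 - 1) (m4 - 1)"
    "m1 + m2 + m3 + m4 = 2 * n \<Longrightarrow> n < 0 \<Longrightarrow> weights (m1 + 1) (m2 + 1) (m3 + 1) (m4 + 1)"
proof -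
  obtain v where v: "weight_vector (of_int (m1 + m2) / 2) (of_int (m1 - m2) / 2)
     (of_int (m3 + m4) / 2) (of_int (m3 - m4) / 2) v"
    using assms by (auto simp: weights_def is_weight_def)
  note W = weight_vector_lower[OF v]
  have e: "of_int (m1 + m2) / 2 + of_int (m1 - m2) / 2 = (of_int m1 :: 'a)"
    "of_int (m1 + m2) / 2 - of_int (m1 - m2) / 2 = (of_int m2 :: 'a)"
    "of_int (m3 + m4) / 2 + of_int (m3 - m4) / 2 = (of_int m3 :: 'a)"
    "of_int (m3 + m4) / 2 - of_int (m3 - m4) / 2 = (of_int m4 :: 'a)"
    by (simp_all add: field_simps)
  have half: "of_int k / 2 + 1 = (of_int (k + 2) / 2 :: 'a)" "of_int k / 2 - 1 = (of_int (k - 2) / 2 :: 'a)" for k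
    by (simp_all add: field_simps)
  have sum: "of_int (m1 + m2) / 2 + of_int (m3 + m4) / 2 = (of_int n :: 'a)"
    if "m1 + m2 + m3 + m4 = 2 * n" for n
  proof -
    have "of_int (m1 + m2) / 2 + of_int (m3 + m4) / 2 = (of_int (m1 + m2 + m3 + m4) / 2 :: 'a)"
      by (simp add: field_simps)
    then show ?thesis unfolding that by simp
  qed
  show "m1 > 0 \<Longrightarrow> weights (m1 - 2) m2 m3 m4" "m1 < 0 \<Longrightarrow> weights (m1 + 2) m2 m3 m4"
    using W(1,2)[OF e(1)] unfolding weights_def is_weight_def half by (simp_all add: algebra_simps)
  show "m2 > 0 \<Longrightarrow> weights m1 (m2 - 2) m3 m4" "m2 < 0 \<Longrightarrow> weights m1 (m2 + 2) m3 m4"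
    using W(3,4)[OF e(2)] unfolding weights_def is_weight_def half by (simp_all add: algebra_simps)
  show "m3 > 0 \<Longrightarrow> weights m1 m2 (m3 - 2) m4" "m3 < 0 \<Longrightarrow> weights m1 m2 (m3 + 2) m4"
    using W(5,6)[OF e(3)] unfolding weights_def is_weight_def half by (simp_all add: algebra_simps)
  show "m4 > 0 \<Longrightarrow> weights m1 m2 m3 (m4 - 2)" "m4 < 0 \<Longrightarrow> weights m1 m2 m3 (m4 + 2)"
    using W(7,8)[OF e(4)] unfolding weights_def is_weight_def half by (simp_all add: algebra_simps)
  show "m1 + m2 + m3 + m4 = 2 * n \<Longrightarrow> n > 0 \<Longrightarrow> weights (m1 - 1) (m2 - 1) (m3 - 1) (m4 - 1)"
    "m1 + m2 + m3 + m4 = 2 * n \<Longrightarrow> n < 0 \<Longrightarrow> weights (m1 + 1) (m2 + 1) (m3 + 1) (m4 + 1)"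
    using W(9,10)[OF sum] unfolding weights_def is_weight_def half by (simp_all add: algebra_simps)
qed

text \<open>Integrality of the coroots gives integral coordinates, and their sum is twice the
  integer \<open>a + c\<close>.\<close>

lemma nonzero_weights:
  obtains m1 m2 m3 m4 where "weights m1 m2 m3 m4" "even (m1 + m2 + m3 + m4)"
    "\<not> (m1 = 0 \<and> m2 = 0 \<and> m3 = 0 \<and> m4 = 0)"
proof -
  obtain a b c d v where v: "weight_vector a b c d v" "\<not> (a = 0 \<and> b = 0 \<and> c = 0 \<and> d = 0)"
    by (rule nonzero_weight_exists)
  then have e: "v \<noteq> 0" "ev 4 2 a v" "ev 1 0 b v" "ev 7 3 c v" "ev 6 5 d v"
    by (simp_all add: weight_vector_def)
  obtain m1 where m1: "a + b = of_int m1" using root_weight[OF _ e(2,3,1)] by auto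
  obtain m2 where m2: "a - b = of_int m2" using root_weight[OF _ e(2) ev_flipI[OF e(3)] e(1)] by auto
  obtain m3 where m3: "c + d = of_int m3" using root_weight[OF _ e(4,5,1)] by auto
  obtain m4 where m4: "c - d = of_int m4" using root_weight[OF _ e(4) ev_flipI[OF e(5)] e(1)] by auto
  obtain n where n: "a + c = of_int n" using root_weight[OF _ e(2,4,1)] by auto
  have abcd: "a = of_int (m1 + m2) / 2" "b = of_int (m1 - m2) / 2"
    "c = of_int (m3 + m4) / 2" "d = of_int (m3 - m4) / 2"
    using m1 m2 m3 m4 by (simp_all flip: m1 m2 m3 m4)
  have "of_int (m1 + m2 + m3 + m4) = (of_int (2 * n) :: 'a)"
    using n by (simp flip: m1 m2 m3 m4 n)
  then have "m1 + m2 + m3 + m4 = 2 * n" by (simp only: of_int_eq_iff)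
  then have "even (m1 + m2 + m3 + m4)" by simp
  moreover have "weights m1 m2 m3 m4"
    using v(1) by (auto simp: weights_def is_weight_def abcd)
  ultimately show ?thesis using that v(2) abcd by fastforce
qed

text \<open>Steps of 2 towards 0 preserve parity and decrease the absolute value. One step across 0
  connects 1 and -1, so both are reached.\<close>

lemma reach_small:
  fixes R :: "int \<Rightarrow> bool"
  assumes "\<And>m. R m \<Longrightarrow> m > 0 \<Longrightarrow> R (m - 2)" "\<And>m. R m \<Longrightarrow> m < 0 \<Longrightarrow> R (m + 2)"
  shows "R m \<Longrightarrow> even m \<Longrightarrow> R 0" "R m \<Longrightarrow> odd m \<Longrightarrow> k = 1 \<or> k = - 1 \<Longrightarrow> R k"
    "R m \<Longrightarrow> even m \<Longrightarrow> m \<noteq> 0 \<Longrightarrow> R 2 \<or> R (- 2)"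
proof -
  show "R m \<Longrightarrow> even m \<Longrightarrow> R 0"
  proof (induction "nat \<bar>m\<bar>" arbitrary: m rule: less_induct)
    case less
    show ?case
    proof (cases "m = 0")
      case False
      then have "m \<ge> 2 \<or> m \<le> - 2" using less.prems(2) by presburger
      then show ?thesis
        using less.hyps[of "m - 2"] less.hyps[of "m + 2"] assms[of m] less.prems by auto
    qed (use less in simp)
  qed
  show "R m \<Longrightarrow> odd m \<Longrightarrow> k = 1 \<or> k = - 1 \<Longrightarrow> R k"
  proof (induction "nat \<bar>m\<bar>" arbitrary: m rule: less_induct)
    case less
    show ?case
    proof (cases "m = 1 \<or> m = - 1")
      case False
      then have "m \<ge> 2 \<or> m \<le> - 2" using less.prems(2) by presburger
      then show ?thesis
        using less.hyps[of "m - 2"] less.hyps[of "m + 2"] assms[of m] less.prems by auto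
    next
      case True
      then show ?thesis using assms(1)[of 1] assms(2)[of "-1"] less.prems by auto
    qed
  qed
  show "R m \<Longrightarrow> even m \<Longrightarrow> m \<noteq> 0 \<Longrightarrow> R 2 \<or> R (- 2)"
  proof (induction "nat \<bar>m\<bar>" arbitrary: m rule: less_induct)
    case less
    show ?case
    proof (cases "m = 2 \<or> m = - 2")
      case False
      then have "m \<ge> 3 \<or> m \<le> - 3" using less.prems(2,3) by presburger
      then show ?thesis
        using less.hyps[of "m - 2"] less.hyps[of "m + 2"] assms[of m] less.prems by auto
    qed (use less in auto)
  qed
qed

lemma reach1:
  "weights m a b c \<Longrightarrow> even m \<Longrightarrow> weights 0 a b c"
  "weights m a b c \<Longrightarrow> odd m \<Longrightarrow> k = 1 \<or> k = - 1 \<Longrightarrow> weights k a b c"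
  "weights m a b c \<Longrightarrow> even m \<Longrightarrow> m \<noteq> 0 \<Longrightarrow> weights 2 a b c \<or> weights (- 2) a b c"
  by (rule reach_small[where R = "\<lambda>m. weights m a b c" and m = m]; (erule (1) weights_step | assumption))+

lemma reach2:
  "weights a m b c \<Longrightarrow> even m \<Longrightarrow> weights a 0 b c"
  "weights a m b c \<Longrightarrow> odd m \<Longrightarrow> k = 1 \<or> k = - 1 \<Longrightarrow> weights a k b c"
  "weights a m b c \<Longrightarrow> even m \<Longrightarrow> m \<noteq> 0 \<Longrightarrow> weights a 2 b c \<or> weights a (- 2) b c"
  by (rule reach_small[where R = "\<lambda>m. weights a m b c" and m = m]; (erule (1) weights_step | assumption))+

lemma reach3:
  "weights a b m c \<Longrightarrow> even m \<Longrightarrow> weights a b 0 c"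
  "weights a b m c \<Longrightarrow> odd m \<Longrightarrow> k = 1 \<or> k = - 1 \<Longrightarrow> weights a b k c"
  "weights a b m c \<Longrightarrow> even m \<Longrightarrow> m \<noteq> 0 \<Longrightarrow> weights a b 2 c \<or> weights a b (- 2) c"
  by (rule reach_small[where R = "\<lambda>m. weights a b m c" and m = m]; (erule (1) weights_step | assumption))+

lemma reach4:
  "weights a b c m \<Longrightarrow> even m \<Longrightarrow> weights a b c 0"
  "weights a b c m \<Longrightarrow> odd m \<Longrightarrow> k = 1 \<or> k = - 1 \<Longrightarrow> weights a b c k"
  "weights a b c m \<Longrightarrow> even m \<Longrightarrow> m \<noteq> 0 \<Longrightarrow> weights a b c 2 \<or> weights a b c (- 2)"
  by (rule reach_small[where R = "\<lambda>m. weights a b c m" and m = m]; (erule (1) weights_step | assumption))+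

section \<open>Counting weights with one separating operator\<close>

text \<open>The factors 1, 2, 10, 20 make the eigenvalues separate all weights that are counted below.\<close>

definition weight_op :: "'w \<Rightarrow> 'w" where
  "weight_op v = im \<odot> (X 4 2 v + 2 \<odot> X 1 0 v + 10 \<odot> X 7 3 v + 20 \<odot> X 6 5 v)"

lemma linear_weight_op: "lin weight_op"
  by (rule linI) (simp_all add: weight_op_def X_lin algebra_simps)

lemma weight_op_eigen:
  assumes "is_weight m1 m2 m3 m4 v"
  shows "weight_op v = (of_int (3 * m1 - m2 + 30 * m3 - 10 * m4) / 2) \<odot> v"
proof -
  have e: "ev 4 2 (of_int (m1 + m2) / 2) v" "ev 1 0 (of_int (m1 - m2) / 2) v"
     "ev 7 3 (of_int (m3 + m4) / 2) v" "ev 6 5 (of_int (m3 - m4) / 2) v"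
    using assms by (auto simp: is_weight_def weight_vector_def)
  have "weight_op v = im \<odot> X 4 2 v + 2 \<odot> im \<odot> X 1 0 v + 10 \<odot> im \<odot> X 7 3 v + 20 \<odot> im \<odot> X 6 5 v"
    by (simp add: weight_op_def scale_right_distrib mult.commute)
  then show ?thesis
    unfolding e[unfolded ev_def] scale_scale scale_left_distrib[symmetric]
    by (simp add: algebra_simps add_divide_distrib diff_divide_distrib)
qed

lemma weights_independent:
  assumes "finite S" "inj_on (\<lambda>(m1, m2, m3, m4). 3 * m1 - m2 + 30 * m3 - 10 * m4) S"
    and w: "\<And>m1 m2 m3 m4. (m1, m2, m3, m4) \<in> S \<Longrightarrow> is_weight m1 m2 m3 m4 (w (m1, m2, m3, m4))"
  shows "independent (w ` S)" "card (w ` S) = card S"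
proof -
  let ?f = "\<lambda>(m1, m2, m3, m4). 3 * m1 - m2 + 30 * m3 - 10 * m4"
  have "inj_on (\<lambda>k. of_int (?f k) / 2 :: 'a) S"
    using assms(2) by (auto simp: inj_on_def simp del: of_int_add of_int_diff of_int_mult)
  moreover have "weight_op (w k) = (of_int (?f k) / 2) \<odot> w k" if "k \<in> S" for k
    using weight_op_eigen w that by (cases k) auto
  moreover have "w k \<noteq> 0" if "k \<in> S" for k
    using w that by (cases k) (auto simp: is_weight_def weight_vector_def)
  ultimately show "independent (w ` S)" "card (w ` S) = card S"
    using eigenvectors_independent[OF linear_weight_op assms(1)] by blast+
qed

lemma weights_bound:
  assumes "finite S" "inj_on (\<lambda>(m1, m2, m3, m4). 3 * m1 - m2 + 30 * m3 - 10 * m4) S"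
    and "\<And>m1 m2 m3 m4. (m1, m2, m3, m4) \<in> S \<Longrightarrow> weights m1 m2 m3 m4"
  shows "card S \<le> 8"
proof -
  have "\<exists>v. is_weight m1 m2 m3 m4 v" if "(m1, m2, m3, m4) \<in> S" for m1 m2 m3 m4
    using assms(3)[OF that] by (simp add: weights_def)
  then obtain w where "\<And>m1 m2 m3 m4. (m1, m2, m3, m4) \<in> S \<Longrightarrow> is_weight m1 m2 m3 m4 (w (m1, m2, m3, m4))"
    using bchoice[of S "\<lambda>(m1, m2, m3, m4) v. is_weight m1 m2 m3 m4 v"] by fastforce
  from weights_independent[OF assms(1,2) this] show ?thesis
    using independent_card_le_dimension dimension_8 by metis
qed

section \<open>Parity patterns of the weights\<close>

lemma not_all_odd:
  assumes "weights m1 m2 m3 m4" "odd m1" "odd m2" "odd m3" "odd m4"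
  shows False
proof -
  \<comment> \<open>Each odd coordinate reaches 1 and -1 independently of the others; sixteen
    separated weights exceed the dimension.\<close>
  let ?S = "{-1, 1 :: int} \<times> {-1, 1 :: int} \<times> {-1, 1 :: int} \<times> {-1, 1 :: int}"
  have S: "weights k1 k2 k3 k4" if "(k1, k2, k3, k4) \<in> ?S" for k1 k2 k3 k4
    using that reach4(2)[OF reach3(2)[OF reach2(2)[OF reach1(2)[OF assms(1)]]]] assms(2-)
    by auto
  have "card ?S \<le> 8"
  proof (rule weights_bound)
    show "inj_on (\<lambda>(m1, m2, m3, m4). 3 * m1 - m2 + 30 * m3 - 10 * m4) ?S"
      by (auto simp: inj_on_def)
  qed (use S in auto)
  then show False by simp
qed

lemma weights_mod_2:
  assumes "weights m1 m2 m3 m4"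
  shows "weights (m1 mod 2) m2 m3 m4" "weights m1 (m2 mod 2) m3 m4"
    "weights m1 m2 (m3 mod 2) m4" "weights m1 m2 m3 (m4 mod 2)"
  using reach1(1)[OF assms] reach2(1)[OF assms] reach3(1)[OF assms] reach4(1)[OF assms]
    reach1(2)[OF assms, where k = 1] reach2(2)[OF assms, where k = 1]
    reach3(2)[OF assms, where k = 1] reach4(2)[OF assms, where k = 1]
  by (simp_all add: mod2_eq_if)

text \<open>A nonzero even coordinate could be brought to 2 or -2 with the others at 0; a step along
  (1, 1, 1, 1) would then make all coordinates odd.\<close>

lemma not_all_even:
  assumes "weights m1 m2 m3 m4" "even m1" "even m2" "even m3" "even m4"
  shows "m1 = 0 \<and> m2 = 0 \<and> m3 = 0 \<and> m4 = 0"
proof (rule ccontr)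
  assume nz: "\<not> ?thesis"
  have False if "weights k1 k2 k3 k4" "\<bar>k1 + k2 + k3 + k4\<bar> = 2" "even k1" "even k2" "even k3" "even k4"
    for k1 k2 k3 k4
    using that(2) weights_step(9)[OF that(1), of 1] weights_step(10)[OF that(1), of "- 1"]
      not_all_odd[of "k1 - 1" "k2 - 1" "k3 - 1" "k4 - 1"]
      not_all_odd[of "k1 + 1" "k2 + 1" "k3 + 1" "k4 + 1"] that(3-6)
    by (auto simp: abs_if split: if_splits)
  note no = this[where ?k1.0 = 2] this[where ?k1.0 = "- 2"] this[where ?k2.0 = 2]
    this[where ?k2.0 = "- 2"] this[where ?k3.0 = 2] this[where ?k3.0 = "- 2"]
    this[where ?k4.0 = 2] this[where ?k4.0 = "- 2"]
  have w1: "weights m1 0 0 0" if "m1 \<noteq> 0"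
    using weights_mod_2(2)[OF weights_mod_2(3)[OF weights_mod_2(4)[OF assms(1)]]] assms by simp
  have w2: "weights 0 m2 0 0" if "m2 \<noteq> 0"
    using weights_mod_2(1)[OF weights_mod_2(3)[OF weights_mod_2(4)[OF assms(1)]]] assms by simp
  have w3: "weights 0 0 m3 0" if "m3 \<noteq> 0"
    using weights_mod_2(1)[OF weights_mod_2(2)[OF weights_mod_2(4)[OF assms(1)]]] assms by simp
  have w4: "weights 0 0 0 m4" if "m4 \<noteq> 0"
    using weights_mod_2(1)[OF weights_mod_2(2)[OF weights_mod_2(3)[OF assms(1)]]] assms by simp
  show False
    using nz no[of 0 0 0] reach1(3)[OF w1] reach2(3)[OF w2] reach3(3)[OF w3] reach4(3)[OF w4]
      assms(2-5) by auto
qed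

text \<open>If \<open>m1\<close> is odd, reduction modulo 2 suffices. Otherwise it gives (0, 0, 1,
  1), which a diagonal step turns into (-1, -1, 0, 0), and odd coordinates may change sign.\<close>

lemma weights_type1I:
  assumes "weights m1 m2 m3 m4" "even (m1 + m2)" "odd (m1 + m3)" "even (m3 + m4)"
  shows "weights 1 1 0 0"
proof (cases "even m1")
  case False
  then show ?thesis
    using weights_mod_2(1)[OF weights_mod_2(2)[OF weights_mod_2(3)[OF weights_mod_2(4)[OF assms(1)]]]]
      assms by (simp add: odd_iff_mod_2_eq_one[symmetric] mod2_eq_if)
next
  case True
  then have "weights 0 0 1 1"
    using weights_mod_2(1)[OF weights_mod_2(2)[OF weights_mod_2(3)[OF weights_mod_2(4)[OF assms(1)]]]]
      assms by (simp add: mod2_eq_if)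
  then have "weights (- 1) (- 1) 0 0" using weights_step(9)[of 0 0 1 1 1] by simp
  then have "weights 1 (- 1) 0 0" by (rule reach1(2)) auto
  then show ?thesis by (rule reach2(2)) auto
qed

text \<open>The sum is even and the extreme patterns are excluded, so exactly two coordinates are
  odd. Complementary patterns are joined by a diagonal step, which leaves three of the six.\<close>

lemma weight_types: "weights 1 1 0 0 \<or> weights 1 0 1 0 \<or> weights 1 0 0 1"
proof -
  obtain m1 m2 m3 m4 where m: "weights m1 m2 m3 m4" "even (m1 + m2 + m3 + m4)"
    "\<not> (m1 = 0 \<and> m2 = 0 \<and> m3 = 0 \<and> m4 = 0)"
    by (rule nonzero_weights)
  have w: "weights (m1 mod 2) (m2 mod 2) (m3 mod 2) (m4 mod 2)"
    using weights_mod_2(1)[OF weights_mod_2(2)[OF weights_mod_2(3)[OF weights_mod_2(4)[OF m(1)]]]] .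
  have neg: "weights 1 0 1 0" if "weights 0 1 0 1"
  proof -
    have "weights (- 1) 0 (- 1) 0" using weights_step(9)[OF that, of 1] by simp
    then have "weights 1 0 (- 1) 0" by (rule reach1(2)) auto
    then show ?thesis by (rule reach3(2)) auto
  qed
  have neg': "weights 1 0 0 1" if "weights 0 1 1 0"
  proof -
    have "weights (- 1) 0 0 (- 1)" using weights_step(9)[OF that, of 1] by simp
    then have "weights 1 0 0 (- 1)" by (rule reach1(2)) auto
    then show ?thesis by (rule reach4(2)) auto
  qed
  show ?thesis
    using w m(2) not_all_even[OF m(1)] m(3) not_all_odd[OF m(1)] weights_type1I[OF m(1)] neg neg'
    by (cases "even m1"; cases "even m2"; cases "even m3"; simp add: mod2_eq_if)
qed

end


section \<open>The vector type\<close>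

text \<open>The matrix \<open>E_pq - E_qp\<close>, the model of \<open>X p q\<close>.\<close>

definition so8_gen :: "8 \<Rightarrow> 8 \<Rightarrow> 'a::field ^ 8 \<Rightarrow> 'a ^ 8" where
  "so8_gen p q x = x $ q *s ebas p - x $ p *s ebas q"

lemma unused_index: "\<exists>t :: 8. t \<notin> {p, q, r, s}"
proof -
  have "card {p, q, r, s} \<le> 4" by (simp add: card_insert_if)
  moreover have "card (UNIV :: 8 set) = 8" by simp
  ultimately have "{p, q, r, s} \<noteq> UNIV" by auto
  then show ?thesis by auto
qed

context so8_irrep
begin

section \<open>The eight weights of the vector type\<close>

context
  assumes type1: "weights 1 1 0 0"
begin

text \<open>In the coordinates of \<open>weight_vector\<close> these are the weights with one entry
  1 or -1 and the rest 0. Sign changes and one diagonal step between the two halves produce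
  them.\<close>

lemma vector_weights:
  assumes "(m1, m2, m3, m4) \<in> {-1, 1} \<times> {-1, 1} \<times> {0} \<times> {0} \<union> {0} \<times> {0} \<times> {-1, 1} \<times> {-1, 1}"
  shows "weights m1 m2 m3 m4"
proof -
  have w1: "weights k1 1 0 0" if "k1 \<in> {-1, 1}" for k1
    using type1 by (rule reach1(2)) (use that in auto)
  have w2: "weights k1 k2 0 0" if "k1 \<in> {-1, 1}" "k2 \<in> {-1, 1}" for k1 k2
    using w1[OF that(1)] by (rule reach2(2)) (use that in auto)
  have w3: "weights 0 0 (- 1) (- 1)" using weights_step(9)[OF type1, of 1] by simp
  have w4: "weights 0 0 k3 (- 1)" if "k3 \<in> {-1, 1}" for k3
    using w3 by (rule reach3(2)) (use that in auto)
  have w5: "weights 0 0 k3 k4" if "k3 \<in> {-1, 1}" "k4 \<in> {-1, 1}" for k3 k4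
    using w4[OF that(1)] by (rule reach4(2)) (use that in auto)
  show ?thesis using assms w2 w5 by auto
qed

text \<open>The eight weights have independent weight vectors, which therefore span the space; a
  linear map that kills vectors of these weights is zero.\<close>

lemma vanishing:
  assumes "lin A" "\<And>a b c d v. weight_vector a b c d v \<Longrightarrow>
    (a = 0 \<and> b = 0 \<and> c = 0 \<and> d\<^sup>2 = 1) \<or> (a = 0 \<and> b = 0 \<and> d = 0 \<and> c\<^sup>2 = 1) \<or>
    (a = 0 \<and> c = 0 \<and> d = 0 \<and> b\<^sup>2 = 1) \<or> (b = 0 \<and> c = 0 \<and> d = 0 \<and> a\<^sup>2 = 1) \<Longrightarrow> A v = 0"
  shows "A w = 0"
proof -
  let ?S = "{-1, 1 :: int} \<times> {-1, 1 :: int} \<times> {0 :: int} \<times> {0 :: int} \<union>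
    {0} \<times> {0} \<times> {-1, 1} \<times> {-1, 1}"
  define u where "u = (\<lambda>(m1, m2, m3, m4). SOME v. is_weight m1 m2 m3 m4 v)"
  have u: "is_weight m1 m2 m3 m4 (u (m1, m2, m3, m4))" if "(m1, m2, m3, m4) \<in> ?S" for m1 m2 m3 m4
    using someI_ex[OF vector_weights[OF that, unfolded weights_def]] by (simp add: u_def)
  have inj: "inj_on (\<lambda>(m1, m2, m3, m4). 3 * m1 - m2 + 30 * m3 - 10 * m4) ?S"
    by (auto simp: inj_on_def)
  have fin: "finite ?S" by simp
  have ind: "independent (u ` ?S)" "card (u ` ?S) = card ?S"
    using u by (intro weights_independent[OF fin inj]; blast)+
  have "card ?S = 8" by (subst card_Un_disjoint) auto
  then have "UNIV \<subseteq> span (u ` ?S)"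
    using ind dimension_8 by (intro card_ge_dim_independent) (simp_all add: dim_UNIV dimension_def)
  then have "w \<in> span (u ` ?S)" by auto
  then show ?thesis
  proof (induction rule: span_induct_alt)
    case base
    show ?case by (simp add: lin_simps[OF assms(1)])
  next
    case (step c x y)
    obtain k where k: "k \<in> ?S" "x = u k" using step(1) by blast
    obtain m1 m2 m3 m4 where "k = (m1, m2, m3, m4)" by (cases k)
    with k have m: "(m1, m2, m3, m4) \<in> ?S" "x = u (m1, m2, m3, m4)" by simp_all
    have "A x = 0"
    proof (rule assms(2))
      show "weight_vector (of_int (m1 + m2) / 2) (of_int (m1 - m2) / 2)
          (of_int (m3 + m4) / 2) (of_int (m3 - m4) / 2) x"
        using u[OF m(1)] unfolding is_weight_def m(2) .
      have "(m1 = 1 \<or> m1 = - 1) \<and> (m2 = 1 \<or> m2 = - 1) \<and> m3 = 0 \<and> m4 = 0 \<or>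
        m1 = 0 \<and> m2 = 0 \<and> (m3 = 1 \<or> m3 = - 1) \<and> (m4 = 1 \<or> m4 = - 1)"
        using m(1) by simp blast
      then show "(of_int (m1 + m2) / 2 = (0 :: 'a) \<and> of_int (m1 - m2) / 2 = (0 :: 'a) \<and>
          of_int (m3 + m4) / 2 = (0 :: 'a) \<and> (of_int (m3 - m4) / 2 :: 'a)\<^sup>2 = 1) \<or>
        (of_int (m1 + m2) / 2 = (0 :: 'a) \<and> of_int (m1 - m2) / 2 = (0 :: 'a) \<and>
          of_int (m3 - m4) / 2 = (0 :: 'a) \<and> (of_int (m3 + m4) / 2 :: 'a)\<^sup>2 = 1) \<or>
        (of_int (m1 + m2) / 2 = (0 :: 'a) \<and> of_int (m3 + m4) / 2 = (0 :: 'a) \<and>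
          of_int (m3 - m4) / 2 = (0 :: 'a) \<and> (of_int (m1 - m2) / 2 :: 'a)\<^sup>2 = 1) \<or>
        (of_int (m1 - m2) / 2 = (0 :: 'a) \<and> of_int (m3 + m4) / 2 = (0 :: 'a) \<and>
          of_int (m3 - m4) / 2 = (0 :: 'a) \<and> (of_int (m1 + m2) / 2 :: 'a)\<^sup>2 = 1)"
        by (elim disjE conjE) simp_all
    qed
    then show ?case using step by (simp add: lin_simps[OF assms(1)])
  qed
qed

lemma linear_X_X: "lin (\<lambda>w. X p q (X r s w))"
  by (rule linI) (simp_all add: X_lin)

lemma planes_orthogonal: "X 1 0 (X 4 2 w) = 0"
proof (rule vanishing[OF linear_X_X])
  fix a b c d v assume "weight_vector a b c d v"
  then have "X 4 2 v = (- im * a) \<odot> v" "X 1 0 v = (- im * b) \<odot> v"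
    by (auto simp: weight_vector_def dest: evD)
  then show "X 1 0 (X 4 2 v) = 0" if "(a = 0 \<and> b = 0 \<and> c = 0 \<and> d\<^sup>2 = 1) \<or>
    (a = 0 \<and> b = 0 \<and> d = 0 \<and> c\<^sup>2 = 1) \<or> (a = 0 \<and> c = 0 \<and> d = 0 \<and> b\<^sup>2 = 1) \<or>
    (b = 0 \<and> c = 0 \<and> d = 0 \<and> a\<^sup>2 = 1)"
    using that by (auto simp: X_lin)
qed

text \<open>Each squared rotation acts on a weight vector as minus the square of one coordinate, and
  these squares add up to 1.\<close>

lemma sum_squares:
  "X 4 2 (X 4 2 w) + X 1 0 (X 1 0 w) + X 7 3 (X 7 3 w) + X 6 5 (X 6 5 w) = - w"
proof -
  let ?A = "\<lambda>w. X 4 2 (X 4 2 w) + X 1 0 (X 1 0 w) + X 7 3 (X 7 3 w) + X 6 5 (X 6 5 w) + w"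
  have "?A w = 0"
  proof (rule vanishing[of ?A])
    show "lin ?A" by (rule linI) (simp_all add: X_lin algebra_simps)
    fix a b c d v assume "weight_vector a b c d v"
    then have e: "X 4 2 v = (- im * a) \<odot> v" "X 1 0 v = (- im * b) \<odot> v"
      "X 7 3 v = (- im * c) \<odot> v" "X 6 5 v = (- im * d) \<odot> v"
      by (auto simp: weight_vector_def dest: evD)
    have s: "im * z * (im * z) = - z\<^sup>2" for z
    proof -
      have "im * z * (im * z) = (im * im) * z\<^sup>2" by (simp only: power2_eq_square mult_ac)
      then show ?thesis by (simp add: im_im)
    qed
    have "?A v = (1 - a\<^sup>2 - b\<^sup>2 - c\<^sup>2 - d\<^sup>2) \<odot> v"
      by (simp add: e X_lin s scale_left_diff_distrib)
    then show "?A v = 0" if "(a = 0 \<and> b = 0 \<and> c = 0 \<and> d\<^sup>2 = 1) \<or>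
      (a = 0 \<and> b = 0 \<and> d = 0 \<and> c\<^sup>2 = 1) \<or> (a = 0 \<and> c = 0 \<and> d = 0 \<and> b\<^sup>2 = 1) \<or>
      (b = 0 \<and> c = 0 \<and> d = 0 \<and> a\<^sup>2 = 1)"
      using that by (elim disjE) simp_all
  qed
  then show ?thesis by (simp add: eq_neg_iff_add_eq_0)
qed

section \<open>Products of disjoint rotations vanish\<close>

definition orth :: "8 \<Rightarrow> 8 \<Rightarrow> 8 \<Rightarrow> 8 \<Rightarrow> bool" where
  "orth p q r s \<longleftrightarrow> distinct [p, q, r, s] \<and> (\<forall>w. X p q (X r s w) = 0)"

lemma orth_swap: "orth p q r s \<Longrightarrow> orth q p r s" "orth p q r s \<Longrightarrow> orth p q s r"
  "orth p q r s \<Longrightarrow> orth r s p q"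
proof -
  show "orth p q r s \<Longrightarrow> orth q p r s" "orth p q r s \<Longrightarrow> orth p q s r"
    unfolding orth_def using X_anti[of q p] X_anti[of s r] by (auto simp: X_lin)
  show "orth p q r s \<Longrightarrow> orth r s p q"
    unfolding orth_def using X_commute[of r s p q] by auto
qed

text \<open>\<open>X r t\<close> is the commutator of \<open>X r s\<close> and \<open>X s t\<close>,
  and \<open>X p q\<close> commutes with \<open>X s t\<close>. The other positions follow by
  symmetry.\<close>

lemma orth_replace:
  assumes "orth p q r s" "t \<notin> {p, q, r, s}"
  shows "orth p q r t" "orth p q t s" "orth p t r s" "orth t q r s"
proof -
  have *: "orth p q r t" if "orth p q r s" "t \<notin> {p, q, r, s}" for p q r s
  proof -
    have "X p q (X r t w) = 0" for w
    proof -
      have "X r t w = X r s (X s t w) - X s t (X r s w)"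
        using X_bracket[of r s t w] that by (auto simp: orth_def)
      moreover have "X p q (X s t (X r s w)) = X s t (X p q (X r s w))"
        using that by (intro X_commute) (auto simp: orth_def)
      ultimately show ?thesis using that by (simp add: orth_def X_lin)
    qed
    then show ?thesis using that by (auto simp: orth_def)
  qed
  show "orth p q r t" by (rule *) fact+
  show "orth p q t s" using *[OF orth_swap(2)[OF assms(1)]] assms(2)
    by (auto intro: orth_swap(2)[of p q s t])
  show "orth p t r s" using *[OF orth_swap(3)[OF assms(1)]] assms(2)
    by (auto intro: orth_swap(3)[of r s p t])
  show "orth t q r s" using *[OF orth_swap(3)[OF orth_swap(1)[OF assms(1)]]] assms(2)
    by (auto intro: orth_swap(1)[OF orth_swap(3)[of r s q t]])
qed

lemma orth_all:
  assumes "distinct [p, q, r, s]"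
  shows "orth p q r s"
proof -
  have "orth 1 0 4 2" using planes_orthogonal by (simp add: orth_def)
  then obtain b c d where 1: "orth p b c d"
    using orth_swap orth_replace(4)[of 1 0 4 2 p] by blast
  have "\<exists>c d. orth p q c d"
  proof (cases "q \<in> {c, d}")
    case True
    then obtain e where e: "orth p b q e" using 1 orth_swap by blast
    obtain t where t: "t \<notin> {p, b, q, e}" using unused_index by blast
    then have "orth p b t e" using orth_replace(2)[OF e] by blast
    moreover have "q \<notin> {p, b, t, e}" using e t by (auto simp: orth_def)
    ultimately show ?thesis using orth_replace(3) by blast
  next
    case False
    then show ?thesis using 1 orth_replace(3)[OF 1, of q] assms by auto
  qed
  then obtain c d where 2: "orth p q c d" by blast
  have "\<exists>d. orth p q r d"
  proof (cases "r = d")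
    case True
    then show ?thesis using 2 orth_swap by blast
  next
    case False
    then show ?thesis using 2 orth_replace(2)[OF 2, of r] assms by auto
  qed
  then obtain d where 3: "orth p q r d" by blast
  then show ?thesis using orth_replace(1)[OF 3, of s] assms by auto
qed

lemma X_X_zero: "distinct [p, q, r, s] \<Longrightarrow> X p q (X r s w) = 0"
  using orth_all by (simp add: orth_def)

section \<open>A vector fixed by so(7) and the images of the standard basis\<close>

text \<open>In the vector representation \<open>X 0 2 (X 2 3 w)\<close> is the matrix unit \<open>E\<^sub>0\<^sub>3\<close> applied to \<open>w\<close>.\<close>

lemma X_X_nonzero: "\<exists>w. X 0 2 (X 2 3 w) \<noteq> 0"
proof (rule ccontr)
  assume "\<not> ?thesis"
  then have Z: "X 0 2 (X 2 3 w) = 0" for w by blast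
  \<comment> \<open>The vanishing passes from \<open>E_03\<close> to the products for
    \<open>E_01\<close>, \<open>E_13\<close> and \<open>E_10\<close>, so that
    \<open>X 1 0 = E_10 - E_01\<close> would vanish.\<close>
  have M01: "X 0 2 (X 2 1 w) = 0" for w
  proof -
    have "X 2 1 w = X 2 3 (X 3 1 w) - X 3 1 (X 2 3 w)" using X_bracket[of 2 3 1 w] by simp
    moreover have "X 0 2 (X 3 1 (X 2 3 w)) = X 3 1 (X 0 2 (X 2 3 w))" by (rule X_commute) simp
    ultimately show ?thesis by (simp add: X_lin Z)
  qed
  have M13: "X 1 2 (X 2 3 w) = 0" for w
  proof -
    have "X 1 2 (X 2 3 w) = X 1 0 (X 0 2 (X 2 3 w)) - X 0 2 (X 1 0 (X 2 3 w))"
      using X_bracket[of 1 0 2 "X 2 3 w"] by simp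
    moreover have "X 1 0 (X 2 3 w) = X 2 3 (X 1 0 w)" by (rule X_commute) simp
    ultimately show ?thesis by (simp add: X_lin Z)
  qed
  have M10: "X 1 2 (X 2 0 w) = 0" for w
  proof -
    have "X 2 0 w = X 2 3 (X 3 0 w) - X 3 0 (X 2 3 w)" using X_bracket[of 2 3 0 w] by simp
    moreover have "X 1 2 (X 3 0 (X 2 3 w)) = X 3 0 (X 1 2 (X 2 3 w))" by (rule X_commute) simp
    ultimately show ?thesis by (simp add: X_lin M13)
  qed
  have "X 2 1 (X 0 2 w) = X 1 2 (X 2 0 w)" for w
    by (simp add: X_anti[of 2 1] X_anti[of 0 2] X_lin)
  then have X01: "X 1 0 w = 0" for w
    using X_bracket[of 0 2 1 w] M01[of w] M10[of w] by (simp add: X_anti[of 1 0])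
  \<comment> \<open>This is the weight with \<open>b = 1\<close>, on which \<open>X 1 0\<close> is
    not zero.\<close>
  have "weights 1 (- 1) 0 0" by (rule vector_weights) simp
  then obtain v where "v \<noteq> 0" "ev 1 0 1 v"
    by (auto simp: weights_def is_weight_def weight_vector_def)
  then show False by (simp add: ev_def X01)
qed

text \<open>The vector \<open>X 0 2 (X 2 3 u)\<close> plays the role of a multiple of
  \<open>e_0\<close>. Its middle index may be any \<open>k\<close> other than 0 and 3; chosen away
  from \<open>a\<close> and \<open>b\<close>, it makes \<open>X a b\<close> kill the vector. Then
  \<open>sum_squares\<close> reduces to the square of \<open>X 1 0\<close>.\<close>

lemma stabilized_vector:
  obtains w where "w \<noteq> 0" "X 1 0 (X 1 0 w) = - w" "\<And>a b. distinct [0, a, b] \<Longrightarrow> X a b w = 0"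
proof -
  obtain u where u: "X 0 2 (X 2 3 u) \<noteq> 0" using X_X_nonzero by blast
  let ?w = "X 0 2 (X 2 3 u)"
  have indep: "?w = X 0 k (X k 3 u)" if "k \<notin> {0, 2, 3}" for k
  proof -
    have d: "distinct [0, k, 2, 3]" "distinct [k, 2, 3]" "distinct [0, k, 2]" using that by auto
    have "?w = X 0 k (X k 2 (X 2 3 u)) - X k 2 (X 0 k (X 2 3 u))"
      using X_bracket[OF d(3), of "X 2 3 u"] by simp
    also have "X k 2 (X 2 3 u) = X 2 3 (X k 2 u) + X k 3 u" by (rule X_bracket[OF d(2)])
    finally show ?thesis by (simp add: X_X_zero[OF d(1)] X_lin)
  qed
  have K: "X a b ?w = 0" if "distinct [0, a, b]" for a b
  proof -
    obtain k where k: "k \<notin> {0, 3, a, b}" using unused_index by blast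
    have "?w = X 0 k (X k 3 u)" using indep[of k] k by (cases "k = 2") auto
    then show ?thesis using X_X_zero[of a b 0 k "X k 3 u"] that k by auto
  qed
  have "X 1 0 (X 1 0 ?w) = - ?w"
    using sum_squares[of ?w] K[of 4 2] K[of 7 3] K[of 6 5] by (simp add: X_lin)
  then show ?thesis using that u K by blast
qed

text \<open>Put \<open>y 0 = w\<close> and \<open>y p = X p 0 w\<close>. For rotations avoiding 0
  the formula follows from the invariance of \<open>w\<close>; the rotations \<open>X b 0\<close>
  are reduced to the known square of \<open>X 1 0\<close>.\<close>

lemma vector_basis:
  obtains y where "y 0 \<noteq> 0"
    "\<And>a b p. a \<noteq> b \<Longrightarrow> X a b (y p) = (if p = b then y a else 0) - (if p = a then y b else 0)"
proof -
  obtain w where w: "w \<noteq> 0" "X 1 0 (X 1 0 w) = - w" and K: "\<And>a b. distinct [0, a, b] \<Longrightarrow> X a b w = 0"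
    by (rule stabilized_vector) blast
  define y where "y p = (if p = 0 then w else X p 0 w)" for p
  have R1: "X a b (y p) = (if p = b then y a else 0) - (if p = a then y b else 0)"
    if "distinct [0, a, b]" for a b p
  proof -
    have b: "X a b (X b 0 w) = X a 0 w" "X b a (X a 0 w) = X b 0 w"
      using X_bracket[of a b 0 w] X_bracket[of b a 0 w] K[of a b] K[of b a] that by (auto simp: X_lin)
    have "X a b (X p 0 w) = 0" if "p \<notin> {0, a, b}"
      using X_commute[of a b p 0 w] K[of a b] \<open>distinct [0, a, b]\<close> that by (auto simp: X_lin)
    then show ?thesis
      using that b K[of a b] by (cases "p \<in> {0, a, b}") (auto simp: y_def X_anti[of a b])
  qed
  have y1: "X 1 0 (y 1) = - w" using w by (simp add: y_def)
  have R2: "X b 0 (y 1) = 0 \<and> X 1 0 (y b) = 0" if b: "distinct [0, 1, b]" for b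
  proof -
    have "X b 0 (X 1 0 w) = X 1 0 (X b 0 w)"
      using X_bracket[of b 0 1 w] K[of b 1] b by (auto simp: X_anti[of 0 1] X_lin)
    then have 1: "X b 0 (y 1) = X 1 0 (y b)" using b by (simp add: y_def)
    \<comment> \<open>A second relation between the two vectors, now with a minus sign, forces both
      to vanish.\<close>
    have "X b 1 (X 1 0 (y 1)) = X 1 0 (X b 1 (y 1)) + X b 0 (y 1)"
      using b by (intro X_bracket) auto
    then have "X 1 0 (y b) + X b 0 (y 1) = 0"
      using R1[of b 1 1] b K[of b 1] by (auto simp: y1 X_lin)
    then have "2 \<odot> X b 0 (y 1) = 0" by (simp add: 1 scale_2)
    then show ?thesis using 1 by simp
  qed
  have R3: "X b 0 (y b) = - w" if b: "distinct [0, 1, b]" for b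
  proof -
    \<comment> \<open>The rotation \<open>X b 1\<close> transports \<open>X 1 0 (y 1) = - w\<close>
      from index 1 to \<open>b\<close>.\<close>
    have "X 0 b (X b 1 (y 1)) = X b 1 (X 0 b (y 1)) + X 0 1 (y 1)"
      using b by (intro X_bracket) auto
    then show ?thesis
      using R1[of b 1 1] R2[OF b] b y1 by (auto simp: X_anti[of 0 b] X_anti[of 0 1] X_lin)
  qed
  have R4: "X b 0 (y a) = 0" if "distinct [0, 1, a, b]" for a b
  proof -
    have "X b 0 (X a 1 (y 1)) = X a 1 (X b 0 (y 1))" using that by (intro X_commute) auto
    then show ?thesis using R1[of a 1 1] R2[of b] that by (auto simp: X_lin)
  qed
  have R5: "X a 0 (y p) = (if p = 0 then y a else 0) - (if p = a then y 0 else 0)" if "a \<noteq> 0" for a p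
    using that R2[of a] R2[of p] R3[of a] R4[of p a] y1 by (cases "a = 1"; cases "p = 1") (auto simp: y_def)
  have "X a b (y p) = (if p = b then y a else 0) - (if p = a then y b else 0)" if "a \<noteq> b" for a b p
    using that R1[of a b p] R5[of a p] R5[of b p]
    by (cases "a = 0"; cases "b = 0") (simp_all add: X_anti[of 0 b])
  then show ?thesis using that[of y] w(1) by (auto simp: y_def)
qed

lemma intertwiner_exists:
  obtains T where "Vector_Spaces.linear (*s) (\<odot>) T" "T \<noteq> (\<lambda>x. 0)"
    "\<And>p q x. p \<noteq> q \<Longrightarrow> T (so8_gen p q x) = X p q (T x)"
proof -
  obtain y where y: "y 0 \<noteq> 0" "\<And>a b p. a \<noteq> b \<Longrightarrow>
      X a b (y p) = (if p = b then y a else 0) - (if p = a then y b else 0)"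
    by (rule vector_basis) blast
  define T where "T x = (\<Sum>p\<in>UNIV. x $ p \<odot> y p)" for x
  have lin: "Vector_Spaces.linear (*s) (\<odot>) T"
    unfolding Vector_Spaces.linear_iff
    by (simp add: T_def vec.vector_space_axioms vector_space_axioms scale_left_distrib sum.distrib
        scale_sum_right)
  have Te: "T (ebas p) = y p" for p
  proof -
    have "T (ebas p) = (\<Sum>q\<in>UNIV. if q = p then y p else 0)"
      unfolding T_def by (intro sum.cong refl) (simp add: ebas_nth)
    then show ?thesis by simp
  qed
  have "T (so8_gen p q x) = X p q (T x)" if "p \<noteq> q" for p q x
  proof -
    have "X p q (T x) = (\<Sum>r\<in>UNIV. (if r = q then x $ r \<odot> y p else 0) - (if r = p then x $ r \<odot> y q else 0))"
      unfolding T_def X_lin by (intro sum.cong refl) (simp add: y(2)[OF that])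
    also have "\<dots> = x $ q \<odot> y p - x $ p \<odot> y q"
      by (simp add: sum_subtractf)
    also have "\<dots> = T (so8_gen p q x)"
      using Vector_Spaces.linear.axioms(3)[OF lin]
      by (simp add: so8_gen_def module_hom.diff module_hom.scale Te)
    finally show ?thesis ..
  qed
  moreover have "T \<noteq> (\<lambda>x. 0)" using Te[of 0] y(1) by metis
  ultimately show ?thesis using that lin by blast
qed

end
end


section \<open>The representation \<open>\<rho>\<^sub>1\<close>\<close>

lemma vec_eq_8: "x = y \<longleftrightarrow> (\<forall>k\<in>{0, 1, 2, 3, 4, 5, 6, 7 :: 8}. x $ k = y $ k)"
proof -
  have "k \<in> {0, 1, 2, 3, 4, 5, 6, 7}" for k :: 8 using exhaust_8[of k] by blast
  then show ?thesis unfolding vec_eq_iff by blast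
qed

lemma sum_UNIV_7: "(\<Sum>i\<in>(UNIV :: 7 set). f i) = f 1 + f 2 + f 3 + f 4 + f 5 + f 6 + f 0"
proof -
  have "(UNIV :: 7 set) = {1, 2, 3, 4, 5, 6, 0}" using exhaust_7 by auto
  then have "sum f UNIV = sum f {1, 2, 3, 4, 5, 6, 0}" by simp
  also have "\<dots> = f 1 + f 2 + f 3 + f 4 + f 5 + f 6 + f 0" by (simp add: add.assoc)
  finally show ?thesis .
qed

lemma pos_simps:
  "pos 0 = 7" "pos 1 = 1" "pos 2 = 2" "pos 3 = 3" "pos 4 = 4" "pos 5 = 5" "pos 6 = 6"
  "pos 7 = 7" "pos 8 = 1" "pos 9 = 2" "pos 10 = 3" "pos 11 = 4" "pos 12 = 5" "pos 13 = 6"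
  "pos 14 = 7" "pos 15 = 1" "pos 16 = 2" "pos 17 = 3" "pos 18 = 4"
  by (simp_all add: pos_def)

section \<open>The maps delta as combinations of rotations\<close>

lemma so8_gen_nth:
  "so8_gen p q x $ k = (if k = p then x $ q else 0) - (if k = q then x $ p else 0)"
  by (simp add: so8_gen_def ebas_nth)

lemma so8_gen_anti: "so8_gen q p x = - so8_gen p q x"
  by (simp add: vec_eq_iff so8_gen_nth)

lemma so8_gen_bracket:
  "distinct [p, q, r] \<Longrightarrow> so8_gen p q (so8_gen q r x) = so8_gen q r (so8_gen p q x) + so8_gen p r x"
  by (auto simp: vec_eq_iff so8_gen_nth)

lemma so8_gen_commute:
  "distinct [p, q, r, s] \<Longrightarrow> so8_gen p q (so8_gen r s x) = so8_gen r s (so8_gen p q x)"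
  by (auto simp: vec_eq_iff so8_gen_nth)

text \<open>The pairs {i+1, i+3}, {i+2, i+6}, {i+4, i+5}, {0, i} partition the eight coordinates, so
  \<open>delta i\<close> rotates four disjoint planes.\<close>

lemma delta_eq_so8_gen:
  "delta i v x = v $ 1 *s so8_gen (pos (i + 3)) (pos (i + 1)) x
     + v $ 2 *s so8_gen (pos (i + 6)) (pos (i + 2)) x
     + v $ 3 *s so8_gen (pos (i + 5)) (pos (i + 4)) x + v $ 4 *s so8_gen (pos i) 0 x"
  by (simp add: delta_def so8_gen_def)

lemma so8_gen_linear:
  "so8_gen p q (x + y) = so8_gen p q x + so8_gen p q y"
  "so8_gen p q (c *s x) = c *s so8_gen p q x"
  by (simp_all add: vec_eq_iff so8_gen_nth right_diff_distrib)

lemma delta_linear: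
  fixes v v' :: "'a::field ^ 4"
  shows "delta i (v + v') x = delta i v x + delta i v' x" "delta i (c *s v) x = c *s delta i v x"
    "delta i v (x + x') = delta i v x + delta i v x'" "delta i v (c *s x) = c *s delta i v x"
proof -
  show "delta i (v + v') x = delta i v x + delta i v' x"
    by (simp add: delta_eq_so8_gen vec.scale_left_distrib)
  show "delta i v (x + x') = delta i v x + delta i v x'"
    by (simp add: delta_eq_so8_gen so8_gen_linear vec.scale_right_distrib)
  show "delta i (c *s v) x = c *s delta i v x" "delta i v (c *s x) = c *s delta i v x"
    by (simp_all add: delta_eq_so8_gen so8_gen_linear vec.scale_right_distrib mult.commute)
qed

text \<open>\<open>sigma1\<close> is the commutator of rotations written in coefficients. With
  \<open>delta_bracket2\<close> and \<open>delta_bracket4\<close> this is the multiplication table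
  up to antisymmetry, checked for each of the seven \<open>i\<close>.\<close>

lemma delta_bracket1:
  fixes r s :: "'a::field ^ 4"
  shows "delta (i + 3) (sigma1 r s) w = delta i r (delta (i + 1) s w) - delta (i + 1) s (delta i r w)"
  using exhaust_7[of i]
  by (elim disjE; simp add: vec_eq_8 delta_eq_so8_gen so8_gen_nth pos_simps sigma1_def vector_4)

lemma delta_bracket2:
  fixes r s :: "'a::field ^ 4"
  shows "delta (i + 6) (sigma2 r s) w = delta i r (delta (i + 2) s w) - delta (i + 2) s (delta i r w)"
  using exhaust_7[of i]
  by (elim disjE; simp add: vec_eq_8 delta_eq_so8_gen so8_gen_nth pos_simps sigma2_def vector_4)

lemma delta_bracket4:
  fixes r s :: "'a::field ^ 4"
  shows "delta (i + 5) (sigma4 r s) w = delta i r (delta (i + 4) s w) - delta (i + 4) s (delta i r w)"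
  using exhaust_7[of i]
  by (elim disjE; simp add: vec_eq_8 delta_eq_so8_gen so8_gen_nth pos_simps sigma4_def vector_4)


lemma delta_commute:
  fixes r s :: "'a::field ^ 4"
  shows "delta i r (delta i s w) = delta i s (delta i r w)"
  using exhaust_7[of i]
  by (elim disjE; simp add: vec_eq_8 delta_eq_so8_gen so8_gen_nth pos_simps)

lemma delta_zero: "delta i 0 w = 0"
  by (simp add: delta_def)

lemma delta_minus: "delta i (- v) w = - delta i v w" for v :: "'a::field ^ 4"
  using delta_linear(2)[of i "- 1" v w] by simp

lemma delta_sum:
  fixes f :: "'b \<Rightarrow> 'a::field ^ 4"
  shows "delta i (\<Sum>k\<in>S. f k) w = (\<Sum>k\<in>S. delta i (f k) w)"
  by (induction S rule: infinite_finite_induct) (simp_all add: delta_zero delta_linear)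

lemma delta_sum_right:
  fixes v :: "'a::field ^ 4"
  shows "delta i v (\<Sum>k\<in>S. g k) = (\<Sum>k\<in>S. delta i v (g k))"
proof (induction S rule: infinite_finite_induct)
  have "delta i v 0 = 0" using delta_linear(4)[of i v 0 0] by simp
  then show "delta i v (\<Sum>k\<in>{}. g k) = (\<Sum>k\<in>{}. delta i v (g k))"
    "infinite S \<Longrightarrow> delta i v (\<Sum>k\<in>S. g k) = (\<Sum>k\<in>S. delta i v (g k))" for S by simp_all
qed (simp add: delta_linear)

text \<open>The nonzero squares modulo 7 are 1, 2, 4 and their negatives are 6, 5, 3; up to
  exchanging \<open>i\<close> and \<open>j\<close> three unequal cases remain.\<close>

lemma index_cases:
  fixes i j :: 7
  obtains "j = i" | "j = i + 1" | "j = i + 2" | "j = i + 4" | "i = j + 1" | "i = j + 2" | "i = j + 4"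
proof -
  have "j - i = 0 \<or> j - i = 1 \<or> j - i = 2 \<or> j - i = 4 \<or> i - j = 1 \<or> i - j = 2 \<or> i - j = 4"
    using exhaust_7[of i] exhaust_7[of j] by (elim disjE) simp_all
  then show ?thesis using that by (auto simp: algebra_simps)
qed

lemma gel_add: "gel i + gel (i + 1) = gel (i + 3)" "gel i + gel (i + 2) = gel (i + 6)"
  "gel i + gel (i + 4) = gel (i + 5)"
  using exhaust_7[of i] by (elim disjE; simp add: gel_def)+

lemma sig_anti: "sig j i s r = - sig i j r s"
  using exhaust_7[of i] exhaust_7[of j] by (elim disjE; simp add: sig_def)

text \<open>For distinct \<open>i\<close> and \<open>j\<close> a single \<open>k\<close>
  contributes; for \<open>i = j\<close> none does, and the operators commute. The sum over
  \<open>k\<close> matches the form of \<open>bracket\<close>.\<close>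

lemma delta_bracket:
  fixes r s :: "'a::field ^ 4"
  shows "(\<Sum>k\<in>UNIV. if gel i + gel j = gel k then delta k (sig i j r s) w else 0)
    = delta i r (delta j s w) - delta j s (delta i r w)"
proof -
  have *: "(\<Sum>k\<in>UNIV. if gel i + gel j = gel k then delta k (sig i j r s) w else 0)
    = delta i r (delta j s w) - delta j s (delta i r w)"
    if "j = i + 1 \<or> j = i + 2 \<or> j = i + 4" for i j and r s :: "'a ^ 4"
    using that
    by (elim disjE) (simp_all add: gel_add gel_inj sig_def delta_bracket1 delta_bracket2 delta_bracket4)
  have **: "(\<Sum>k\<in>UNIV. if gel i + gel j = gel k then delta k (sig i j r s) w else 0)
    = delta i r (delta j s w) - delta j s (delta i r w)"
    if "i = j + 1 \<or> i = j + 2 \<or> i = j + 4" for i j and r s :: "'a ^ 4"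
  proof -
    have "(\<Sum>k\<in>UNIV. if gel i + gel j = gel k then delta k (sig i j r s) w else 0)
      = - (\<Sum>k\<in>UNIV. if gel j + gel i = gel k then delta k (sig j i s r) w else 0)"
      unfolding sum_negf[symmetric] sig_anti[of i j r s]
      by (intro sum.cong refl) (simp add: delta_minus add.commute)
    then show ?thesis unfolding *[OF that] by simp
  qed
  show ?thesis
    by (rule index_cases[of j i]) (use * ** in \<open>auto simp: gel_nonzero delta_commute\<close>)
qed

lemma rho1_bracket: "rho1 (bracket x y) w = rho1 x (rho1 y w) - rho1 y (rho1 x w)"
proof -
  have "rho1 (bracket x y) w = (\<Sum>k\<in>UNIV. \<Sum>i\<in>UNIV. \<Sum>j\<in>UNIV.
      if gel i + gel j = gel k then delta k (sig i j (x $ i) (y $ j)) w else 0)"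
    by (simp add: rho1_def bracket_def delta_sum if_distrib[of "\<lambda>v. delta _ v w"] delta_zero
        cong: if_cong)
  also have "\<dots> = (\<Sum>i\<in>UNIV. \<Sum>k\<in>UNIV. \<Sum>j\<in>UNIV.
      if gel i + gel j = gel k then delta k (sig i j (x $ i) (y $ j)) w else 0)"
    by (rule sum.swap)
  also have "\<dots> = (\<Sum>i\<in>UNIV. \<Sum>j\<in>UNIV. \<Sum>k\<in>UNIV.
      if gel i + gel j = gel k then delta k (sig i j (x $ i) (y $ j)) w else 0)"
    by (intro sum.cong refl sum.swap)
  also have "\<dots> = (\<Sum>i\<in>UNIV. \<Sum>j\<in>UNIV. delta i (x $ i) (delta j (y $ j) w))
      - (\<Sum>i\<in>UNIV. \<Sum>j\<in>UNIV. delta j (y $ j) (delta i (x $ i) w))"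
    by (simp add: delta_bracket sum_subtractf)
  also have "(\<Sum>i\<in>UNIV. \<Sum>j\<in>UNIV. delta j (y $ j) (delta i (x $ i) w)) =
      (\<Sum>j\<in>UNIV. \<Sum>i\<in>UNIV. delta j (y $ j) (delta i (x $ i) w))"
    by (rule sum.swap)
  finally show ?thesis by (simp add: rho1_def delta_sum_right)
qed

lemma vector_space_scaleL: "vector_space (scaleL :: 'a::field \<Rightarrow> _)"
  by unfold_locales (simp_all add: vec_eq_iff scaleL_def algebra_simps)

lemma rho1_linear:
  "rho1 (x + y) w = rho1 x w + rho1 y w" "rho1 (scaleL c x) w = c *s rho1 x w"
  "rho1 x (v + w) = rho1 x v + rho1 x w" "rho1 x (c *s w) = c *s rho1 x w"
  by (simp_all add: rho1_def delta_linear sum.distrib scaleL_def vec.scale_sum_right)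

lemma lie_rep_rho1: "lie_rep scaleL bracket (*s) rho1"
  unfolding lie_rep_def Vector_Spaces.linear_iff
  by (simp add: rho1_linear rho1_bracket vector_space_scaleL vec.vector_space_axioms)

lemma rho1_axis_eq: "rho1 (axis i v) w = delta i v w"
  unfolding rho1_def by (rule sum_delta_axis[where f = "\<lambda>v. v"]) simp

section \<open>Identification of the Lie algebra with so(8)\<close>

lemma rho1_axis_axis:
  "rho1 (axis i (axis 1 1)) w = so8_gen (pos (i + 3)) (pos (i + 1)) w"
  "rho1 (axis i (axis 2 1)) w = so8_gen (pos (i + 6)) (pos (i + 2)) w"
  "rho1 (axis i (axis 3 1)) w = so8_gen (pos (i + 5)) (pos (i + 4)) w"
  "rho1 (axis i (axis 4 1)) w = so8_gen (pos i) 0 w"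
  unfolding rho1_axis_eq delta_eq_so8_gen by (simp_all add: axis_def)

text \<open>The planes of the \<open>delta i\<close> have index differences 2, 4, 1 modulo 7, which
  up to sign are all nonzero residues; so every pair of nonzero indices occurs, and {0, i} supplies
  the rest.\<close>

lemma rho1_onto_so8: "\<exists>x. \<forall>w :: 'a::field ^ 8. rho1 x w = so8_gen p q w"
proof -
  define G where "G p q \<longleftrightarrow> (\<exists>x. \<forall>w :: 'a ^ 8. rho1 x w = so8_gen p q w)" for p q
  have refl: "G p p" for p
    unfolding G_def by (rule exI[of _ 0]) (simp add: rho1_def delta_zero so8_gen_def)
  have sym: "G q p" if "G p q" for p q
  proof -
    from that obtain x where x: "\<And>w :: 'a ^ 8. rho1 x w = so8_gen p q w" unfolding G_def by blast
    have "rho1 (scaleL (- 1) x) w = so8_gen q p w" for w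
      by (simp add: rho1_linear x so8_gen_anti[of q p])
    then show ?thesis unfolding G_def by blast
  qed
  have g: "G (pos (i + 3)) (pos (i + 1))" "G (pos (i + 6)) (pos (i + 2))"
    "G (pos (i + 5)) (pos (i + 4))" "G (pos i) 0" for i
    unfolding G_def using rho1_axis_axis[of i] by blast+
  have g': "G (pos (i + 1)) (pos (i + 3))" "G (pos (i + 2)) (pos (i + 6))"
    "G (pos (i + 4)) (pos (i + 5))" "G 0 (pos i)" for i
    by (rule sym, rule g)+
  note G = g[of 0] g[of 1] g[of 2] g[of 3] g[of 4] g[of 5] g[of 6]
    g'[of 0] g'[of 1] g'[of 2] g'[of 3] g'[of 4] g'[of 5] g'[of 6]
  note G' = G[simplified, unfolded pos_simps]
  have "G p q"
    using exhaust_8[of p] exhaust_8[of q] by (elim disjE; simp only: refl G')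
  then show ?thesis unfolding G_def .
qed

text \<open>The preimage under \<open>rho1\<close> of \<open>E_pq - E_qp\<close>; the choice is
  unique by \<open>rho1_injective\<close>.\<close>

definition elt :: "8 \<Rightarrow> 8 \<Rightarrow> ('a::field ^ 4) ^ 7" where
  "elt p q = (SOME x. \<forall>w. rho1 x w = so8_gen p q w)"

lemma rho1_elt: "rho1 (elt p q) w = so8_gen p q w"
  using someI_ex[OF rho1_onto_so8[of p q]] unfolding elt_def by blast

text \<open>Each coefficient of \<open>x\<close> is a matrix entry of \<open>rho1 x\<close>.\<close>

lemma rho1_injective:
  assumes "\<And>w. rho1 x w = rho1 y w"
  shows "x = y"
proof -
  have "x $ i $ 1 = rho1 x (ebas (pos (i + 1))) $ pos (i + 3)"
    "x $ i $ 2 = rho1 x (ebas (pos (i + 2))) $ pos (i + 6)"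
    "x $ i $ 3 = rho1 x (ebas (pos (i + 4))) $ pos (i + 5)"
    "x $ i $ 4 = rho1 x (ebas 0) $ pos i" for i and x :: "('a ^ 4) ^ 7"
    unfolding rho1_def sum_UNIV_7 using exhaust_7[of i]
    by (elim disjE; simp add: delta_eq_so8_gen so8_gen_nth ebas_nth pos_simps)+
  then have "x $ i $ k = y $ i $ k" for i k
    using exhaust_4[of k] assms by metis
  then show ?thesis by (simp add: vec_eq_iff)
qed

lemma lie_rep_simps:
  assumes "lie_rep scaleL bracket sW \<phi>"
  shows "\<phi> (x + y) w = \<phi> x w + \<phi> y w" "\<phi> (- x) w = - \<phi> x w" "\<phi> (scaleL c x) w = sW c (\<phi> x w)"
    "\<phi> (\<Sum>i\<in>S. f i) w = (\<Sum>i\<in>S. \<phi> (f i) w)"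
    "\<phi> (bracket x y) w = \<phi> x (\<phi> y w) - \<phi> y (\<phi> x w)" "Vector_Spaces.linear sW sW (\<phi> x)"
    "vector_space sW"
proof -
  have l: "Vector_Spaces.linear scaleL sW (\<lambda>x. \<phi> x w)" for w
    using assms by (simp add: lie_rep_def)
  then interpret module_hom scaleL sW "\<lambda>x. \<phi> x w" for w
    by (rule Vector_Spaces.linear.axioms(3))
  show "\<phi> (x + y) w = \<phi> x w + \<phi> y w" "\<phi> (- x) w = - \<phi> x w" "\<phi> (scaleL c x) w = sW c (\<phi> x w)"
    "\<phi> (\<Sum>i\<in>S. f i) w = (\<Sum>i\<in>S. \<phi> (f i) w)"
    by (simp_all add: add neg scale sum)
  show "\<phi> (bracket x y) w = \<phi> x (\<phi> y w) - \<phi> y (\<phi> x w)" "Vector_Spaces.linear sW sW (\<phi> x)"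
    using assms by (simp_all add: lie_rep_def)
  show "vector_space sW" by (rule Vector_Spaces.linear.axioms(2)[OF l])
qed

lemma elt_decomposition:
  "x = (\<Sum>i\<in>UNIV. scaleL (x $ i $ 1) (elt (pos (i + 3)) (pos (i + 1)))
    + scaleL (x $ i $ 2) (elt (pos (i + 6)) (pos (i + 2)))
    + scaleL (x $ i $ 3) (elt (pos (i + 5)) (pos (i + 4))) + scaleL (x $ i $ 4) (elt (pos i) 0))"
  by (rule rho1_injective)
    (simp add: lie_rep_simps[OF lie_rep_rho1] rho1_elt, simp add: rho1_def delta_eq_so8_gen)

text \<open>Invariance and intertwining need only be checked on the rotations
  \<open>elt p q\<close>, since these span the Lie algebra.\<close>

lemma lie_rep_expand:
  assumes "lie_rep scaleL bracket sW \<phi>"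
  shows "\<phi> x w = (\<Sum>i\<in>UNIV. sW (x $ i $ 1) (\<phi> (elt (pos (i + 3)) (pos (i + 1))) w)
    + sW (x $ i $ 2) (\<phi> (elt (pos (i + 6)) (pos (i + 2))) w)
    + sW (x $ i $ 3) (\<phi> (elt (pos (i + 5)) (pos (i + 4))) w) + sW (x $ i $ 4) (\<phi> (elt (pos i) 0) w))"
  by (subst elt_decomposition[of x]) (simp add: lie_rep_simps[OF assms])

text \<open>The faithful \<open>rho1\<close> carries the identities to those between matrices of
  so(8).\<close>

lemma elt_relations:
  "elt q p = - elt p q"
  "distinct [p, q, r] \<Longrightarrow> bracket (elt p q) (elt q r) = elt p r"
  "distinct [p, q, r, s] \<Longrightarrow> bracket (elt p q) (elt r s) = 0"
proof -
  note simps = lie_rep_simps[OF lie_rep_rho1] rho1_elt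
  show "elt q p = - elt p q"
    by (rule rho1_injective) (simp add: simps so8_gen_anti[of q p])
  show "distinct [p, q, r] \<Longrightarrow> bracket (elt p q) (elt q r) = elt p r"
    by (rule rho1_injective) (simp add: simps so8_gen_bracket)
  show "distinct [p, q, r, s] \<Longrightarrow> bracket (elt p q) (elt r s) = 0"
    using so8_gen_commute[of p q r s]
    by (intro rho1_injective) (simp add: simps, simp add: rho1_def delta_zero)
qed

text \<open>A product of two rotations is a matrix unit, which extracts a basis vector from a
  nonzero \<open>u\<close>; further rotations produce the others.\<close>

lemma irreducible_rho1: "irreducible_lie_rep scaleL bracket (*s) rho1"
  unfolding irreducible_lie_rep_def
proof (intro conjI allI impI lie_rep_rho1)
  show "(UNIV :: ('a ^ 8) set) \<noteq> {0}"
    by (metis UNIV_I ebas_nth singletonD zero_index zero_neq_one)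
  fix U :: "('a ^ 8) set"
  assume "vec.subspace U \<and> (\<forall>x. \<forall>u\<in>U. rho1 x u \<in> U)"
  then have sub: "vec.subspace U" and inv: "\<And>p q u. u \<in> U \<Longrightarrow> so8_gen p q u \<in> U"
    by (auto simp flip: rho1_elt)
  show "U = {0} \<or> U = UNIV"
  proof (cases "\<exists>u\<in>U. u \<noteq> 0")
    case True
    then obtain u j where u: "u \<in> U" "u $ j \<noteq> 0" by (auto simp: vec_eq_iff)
    obtain k where k: "k \<notin> {j, j, j, j}" using unused_index by blast
    obtain l where l: "l \<notin> {j, k, j, k}" using unused_index by blast
    have "so8_gen l k (so8_gen k j u) = u $ j *s ebas l"
      using k l by (auto simp: vec_eq_iff so8_gen_nth ebas_nth)
    moreover have "so8_gen l k (so8_gen k j u) \<in> U" by (intro inv u)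
    ultimately have "ebas l \<in> U"
      using vec.subspace_scale[OF sub, of "u $ j *s ebas l" "inverse (u $ j)"] u by simp
    then have "so8_gen p l (ebas l) \<in> U" for p by (rule inv)
    moreover have "so8_gen p l (ebas l) = ebas p" if "p \<noteq> l" for p
      using that by (auto simp: vec_eq_iff so8_gen_nth ebas_nth)
    ultimately have "ebas p \<in> U" for p using \<open>ebas l \<in> U\<close> by metis
    then have "(\<Sum>p\<in>UNIV. x $ p *s ebas p) \<in> U" for x
      by (intro vec.subspace_sum[OF sub] vec.subspace_scale[OF sub])
    moreover have "(\<Sum>p\<in>UNIV. x $ p *s ebas p) = x" for x
      unfolding ebas_def by (rule basis_expansion)
    ultimately have "x \<in> U" for x by metis
    then show ?thesis by blast
  next
    case False
    then show ?thesis using vec.subspace_0[OF sub] by blast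
  qed
qed


section \<open>Triality and classification\<close>

text \<open>The vector (1, 1, 1, -1) has square length 4, so this is the orthogonal reflection along
  it; likewise \<open>refl3\<close> for (1, 1, 1, 1).\<close>

definition refl2 :: "'a::field ^ 4 \<Rightarrow> 'a ^ 4" where
  "refl2 v = v - ((v$1 + v$2 + v$3 - v$4) / 2) *s vector [1, 1, 1, -1]"

definition refl3 :: "'a::field ^ 4 \<Rightarrow> 'a ^ 4" where
  "refl3 v = v - ((v$1 + v$2 + v$3 + v$4) / 2) *s vector [1, 1, 1, 1]"

text \<open>The other products are negatives of these three with arguments exchanged, so applying
  \<open>M\<close> to every coefficient is an automorphism of the Lie algebra.\<close>

definition sigma_aut :: "('a::field ^ 4 \<Rightarrow> 'a ^ 4) \<Rightarrow> bool" where
  "sigma_aut M \<longleftrightarrow> (\<forall>u v. M (u + v) = M u + M v) \<and> (\<forall>c v. M (c *s v) = c *s M v) \<and>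
     (\<forall>v. M (M v) = v) \<and> (\<forall>r s. sigma1 (M r) (M s) = M (sigma1 r s)) \<and>
     (\<forall>r s. sigma2 (M r) (M s) = M (sigma2 r s)) \<and> (\<forall>r s. sigma4 (M r) (M s) = M (sigma4 r s))"

definition map_coeffs :: "('a::field ^ 4 \<Rightarrow> 'a ^ 4) \<Rightarrow> ('a ^ 4) ^ 7 \<Rightarrow> ('a ^ 4) ^ 7" where
  "map_coeffs M x = (\<chi> i. M (x $ i))"

lemma refl2_nth:
  fixes v :: "'a::field ^ 4"
  shows "refl2 v $ 1 = v$1 - (v$1 + v$2 + v$3 - v$4) / 2" "refl2 v $ 2 = v$2 - (v$1 + v$2 + v$3 - v$4) / 2"
    "refl2 v $ 3 = v$3 - (v$1 + v$2 + v$3 - v$4) / 2" "refl2 v $ 4 = v$4 + (v$1 + v$2 + v$3 - v$4) / 2"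
  by (simp_all add: refl2_def vector_4)

lemma refl3_nth:
  fixes v :: "'a::field ^ 4"
  shows "refl3 v $ 1 = v$1 - (v$1 + v$2 + v$3 + v$4) / 2" "refl3 v $ 2 = v$2 - (v$1 + v$2 + v$3 + v$4) / 2"
    "refl3 v $ 3 = v$3 - (v$1 + v$2 + v$3 + v$4) / 2" "refl3 v $ 4 = v$4 - (v$1 + v$2 + v$3 + v$4) / 2"
  by (simp_all add: refl3_def vector_4)

lemma sigma_aut_refl2: "sigma_aut (refl2 :: 'a::field_char_0 ^ 4 \<Rightarrow> 'a ^ 4)"
  unfolding sigma_aut_def vec_eq_iff forall_4
  by (simp add: refl2_nth sigma1_def sigma2_def sigma4_def vector_4; simp add: field_simps)

lemma sigma_aut_refl3: "sigma_aut (refl3 :: 'a::field_char_0 ^ 4 \<Rightarrow> 'a ^ 4)"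
  unfolding sigma_aut_def vec_eq_iff forall_4
  by (simp add: refl3_nth sigma1_def sigma2_def sigma4_def vector_4; simp add: field_simps)

lemma rho2_eq: "rho2 x = rho1 (map_coeffs refl2 x)"
  by (rule ext) (simp add: rho1_def rho2_def map_coeffs_def refl2_def)

lemma rho3_eq: "rho3 x = rho1 (map_coeffs refl3 x)"
  by (rule ext) (simp add: rho1_def rho3_def map_coeffs_def refl3_def)

lemma map_coeffs_aut:
  assumes "sigma_aut M"
  shows "map_coeffs M (x + y) = map_coeffs M x + map_coeffs M y"
    "map_coeffs M (scaleL c x) = scaleL c (map_coeffs M x)"
    "map_coeffs M (map_coeffs M x) = x"
    "map_coeffs M (bracket x y) = bracket (map_coeffs M x) (map_coeffs M y)"
proof -
  have M: "M (u + v) = M u + M v" "M (c *s v) = c *s M v" "M (M v) = v"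
    "sigma1 (M r) (M s) = M (sigma1 r s)" "sigma2 (M r) (M s) = M (sigma2 r s)"
    "sigma4 (M r) (M s) = M (sigma4 r s)" for u v c r s
    using assms by (simp_all add: sigma_aut_def)
  show "map_coeffs M (x + y) = map_coeffs M x + map_coeffs M y"
    "map_coeffs M (scaleL c x) = scaleL c (map_coeffs M x)"
    "map_coeffs M (map_coeffs M x) = x"
    by (simp_all add: map_coeffs_def scaleL_def M vec_eq_iff[where 'b = 7])
  have M0: "M 0 = 0" using M(2)[of 0 0] by simp
  have Mm: "M (- v) = - M v" for v using M(2)[of "- 1" v] by simp
  have sum: "M (\<Sum>k\<in>S. f k) = (\<Sum>k\<in>S. M (f k))" for S :: "7 set" and f
    by (induction S rule: infinite_finite_induct) (simp_all add: M M0)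
  have "sig i j (M r) (M s) = M (sig i j r s)" for i j r s
    by (simp add: sig_def M M0 Mm)
  then show "map_coeffs M (bracket x y) = bracket (map_coeffs M x) (map_coeffs M y)"
    by (simp add: map_coeffs_def bracket_def sum if_distrib[of M] M0 cong: if_cong)
qed

text \<open>An involution is onto, so the twisted representation has the same operators and the same
  invariant subspaces.\<close>

lemma irreducible_map_coeffs:
  assumes M: "sigma_aut M" and irr: "irreducible_lie_rep scaleL bracket sW \<phi>"
  shows "irreducible_lie_rep scaleL bracket sW (\<lambda>x. \<phi> (map_coeffs M x))"
proof -
  have lie: "lie_rep scaleL bracket sW \<phi>" using irr by (simp add: irreducible_lie_rep_def)
  note simps = lie_rep_simps[OF lie]
  have "lie_rep scaleL bracket sW (\<lambda>x. \<phi> (map_coeffs M x))"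
    unfolding lie_rep_def
  proof (intro conjI allI)
    show "Vector_Spaces.linear sW sW (\<phi> (map_coeffs M x))" for x by (rule simps)
    show "Vector_Spaces.linear scaleL sW (\<lambda>x. \<phi> (map_coeffs M x) w)" for w
      unfolding Vector_Spaces.linear_iff
      by (simp add: map_coeffs_aut[OF M] simps(1,3,7) vector_space_scaleL)
  qed (simp add: map_coeffs_aut[OF M] simps)
  moreover have "(\<forall>x. \<forall>u\<in>U. \<phi> x u \<in> U)" if "\<forall>x. \<forall>u\<in>U. \<phi> (map_coeffs M x) u \<in> U" for U
    using that map_coeffs_aut(3)[OF M] by metis
  ultimately show ?thesis
    using irr unfolding irreducible_lie_rep_def by blast
qed

lemma equivalent_map_coeffs:
  assumes "sigma_aut M" "equivalent_reps sV (\<lambda>x. \<phi> (map_coeffs M x)) sW \<psi>"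
  shows "equivalent_reps sV \<phi> sW (\<lambda>x. \<psi> (map_coeffs M x))"
  using assms(2) map_coeffs_aut(3)[OF assms(1)] unfolding equivalent_reps_def by metis

section \<open>From irreducible representations to the weight theory\<close>

lemma so8_irrep_of_lie_rep:
  fixes sW :: "'a::{alg_closed_field, field_char_0} \<Rightarrow> 'w::ab_group_add \<Rightarrow> 'w"
  assumes irr: "irreducible_lie_rep scaleL bracket sW \<phi>" and dim: "vector_space.dim sW (UNIV :: 'w set) = 8"
    and im: "im * im = - 1"
  obtains B where "so8_irrep sW B im (\<lambda>p q. \<phi> (elt p q))"
proof -
  have lie: "lie_rep scaleL bracket sW \<phi>" using irr by (simp add: irreducible_lie_rep_def)
  note simps = lie_rep_simps[OF lie]
  interpret vector_space sW by (rule simps)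
  obtain B where B: "independent B" "UNIV \<subseteq> span B" "card B = 8"
    using basis_exists[of UNIV] dim by metis
  have fin: "finite B" using B(3) by (metis card.infinite zero_neq_numeral)
  interpret fd: finite_dimensional_vector_space sW B
    by unfold_locales (use B fin in auto)
  have "so8_irrep sW B im (\<lambda>p q. \<phi> (elt p q))"
  proof (intro so8_irrep.intro ac_vector_space.intro so8_irrep_axioms.intro
      fd.finite_dimensional_vector_space_axioms)
    show "im * im = - 1" by (rule im)
    show "Vector_Spaces.linear sW sW (\<phi> (elt p q))" for p q by (rule simps)
    show "\<phi> (elt q p) w = - \<phi> (elt p q) w" for p q w
      by (subst elt_relations(1)) (rule simps)
    show "\<phi> (elt p q) (\<phi> (elt q r) w) = \<phi> (elt q r) (\<phi> (elt p q) w) + \<phi> (elt p r) w"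
      if "distinct [p, q, r]" for p q r w
      using simps(5)[of "elt p q" "elt q r" w] by (simp add: elt_relations(2)[OF that] algebra_simps)
    show "\<phi> (elt p q) (\<phi> (elt r s) w) = \<phi> (elt r s) (\<phi> (elt p q) w)"
      if "distinct [p, q, r, s]" for p q r s w
      \<comment> \<open>The empty sum gives \<open>\<phi> 0 w = 0\<close>.\<close>
      using simps(5)[of "elt p q" "elt r s" w] simps(4)[of "\<lambda>x. x" "{}" w]
      by (simp add: elt_relations(3)[OF that])
    show "fd.dimension = 8" using B(3) by (simp add: fd.dimension_def)
    show "U = {0} \<or> U = UNIV"
      if sub: "subspace U" and inv: "\<And>p q u. u \<in> U \<Longrightarrow> \<phi> (elt p q) u \<in> U" for U
    proof -
      have "\<phi> x u \<in> U" if "u \<in> U" for x u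
        unfolding lie_rep_expand[OF lie, of x]
        by (intro subspace_sum[OF sub] subspace_add[OF sub] subspace_scale[OF sub] inv that)
      then show ?thesis using irr sub unfolding irreducible_lie_rep_def by blast
    qed
  qed
  then show ?thesis by (rule that)
qed

text \<open>There is a nonzero intertwiner from \<open>rho1\<close>; its kernel and range are
  invariant, so it is bijective. The equivalence is its inverse.\<close>

lemma vector_type_equivalent:
  fixes sW :: "'a::{alg_closed_field, field_char_0} \<Rightarrow> 'w::ab_group_add \<Rightarrow> 'w"
  assumes irr: "irreducible_lie_rep scaleL bracket sW \<phi>"
    and so8: "so8_irrep sW B im (\<lambda>p q. \<phi> (elt p q))"
    and wt: "so8_irrep.weights sW im (\<lambda>p q. \<phi> (elt p q)) 1 1 0 0"
  shows "equivalent_reps sW \<phi> (*s) rho1"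
proof -
  have lie: "lie_rep scaleL bracket sW \<phi>" using irr by (simp add: irreducible_lie_rep_def)
  interpret so8_irrep sW B im "\<lambda>p q. \<phi> (elt p q)" by (rule so8)
  obtain T where T: "Vector_Spaces.linear (*s) sW T" "T \<noteq> (\<lambda>x. 0)"
    and intertw: "\<And>p q x. p \<noteq> q \<Longrightarrow> T (so8_gen p q x) = \<phi> (elt p q) (T x)"
    using intertwiner_exists[OF wt] by blast
  interpret T: module_hom "(*s)" sW T using Vector_Spaces.linear.axioms(3)[OF T(1)] .
  have T_rho1: "T (rho1 x w) = \<phi> x (T w)" for x w
    by (simp add: lie_rep_expand[OF lie_rep_rho1, of x] lie_rep_expand[OF lie, of x] rho1_elt
        intertw T.sum T.add T.scale pos_inj pos_nonzero)
  have "vec.subspace {w. T w = 0}"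
    by (auto simp: vec.subspace_def T.add T.scale T.zero)
  moreover have "rho1 x w \<in> {w. T w = 0}" if "w \<in> {w. T w = 0}" for x w
    using that lin_simps(4)[OF lie_rep_simps(6)[OF lie]] by (simp add: T_rho1)
  ultimately have "{w. T w = 0} = {0} \<or> {w. T w = 0} = UNIV"
    using irreducible_rho1 unfolding irreducible_lie_rep_def by blast
  then have inj: "inj T" using T(2) by (auto simp: T.inj_iff_eq_0)
  have "subspace (range T)"
    using T.subspace_image[of UNIV] by simp
  moreover have "\<phi> x w \<in> range T" if "w \<in> range T" for x w
    using that by (auto simp flip: T_rho1)
  ultimately have "range T = {0} \<or> range T = UNIV"
    using irr unfolding irreducible_lie_rep_def by blast
  moreover have "range T \<noteq> {0}" using T(2) by (metis ext rangeI singletonD)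
  ultimately have "range T = UNIV" by blast
  then have bij: "bij T" using inj by (simp add: bij_def)
  define S where "S = inv T"
  have S: "T (S w) = w" "S (T x) = x" for w x
    using bij by (simp_all add: S_def bij_is_surj surj_f_inv_f bij_is_inj)
  have "S (v + w) = S v + S w" "S (sW c w) = c *s S w" "S (\<phi> x w) = rho1 x (S w)" for v w c x
    by (metis S T.add, metis S T.scale, metis S T_rho1)
  then have "Vector_Spaces.linear sW (*s) S"
    by (simp add: Vector_Spaces.linear_iff vector_space_axioms vec.vector_space_axioms)
  moreover have "bij S" unfolding S_def by (rule bij_imp_bij_inv[OF bij])
  ultimately show ?thesis
    unfolding equivalent_reps_def using \<open>\<And>x w. S (\<phi> x w) = rho1 x (S w)\<close> by blast
qed

section \<open>Reflected weights and the classification\<close>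

lemma elt_cartan:
  "elt 4 2 = axis 1 (axis 1 1)" "elt 7 3 = axis 1 (axis 2 1)" "elt 6 5 = axis 1 (axis 3 1)"
  "elt 1 0 = axis 1 (axis 4 1)"
  by (rule rho1_injective; simp add: rho1_elt rho1_axis_axis pos_simps)+

text \<open>The twist preserves \<open>V g_1\<close>, so it only mixes the four Cartan rotations.
  The planes appear in the order of the coefficients, not in that of
  \<open>weight_vector\<close>.\<close>

lemma lie_rep_map_coeffs_axis:
  assumes "lie_rep scaleL bracket sW \<phi>" "sigma_aut M"
  shows "\<phi> (map_coeffs M (axis 1 v)) w = sW (M v $ 1) (\<phi> (elt 4 2) w) + sW (M v $ 2) (\<phi> (elt 7 3) w)
    + sW (M v $ 3) (\<phi> (elt 6 5) w) + sW (M v $ 4) (\<phi> (elt 1 0) w)"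
proof -
  have M0: "M 0 = 0" using assms(2) unfolding sigma_aut_def by (metis vec.scale_zero_left)
  have *: "map_coeffs M (axis 1 v) $ i = (if i = 1 then M v else 0)" for i
    by (simp add: map_coeffs_def axis_def M0)
  interpret vector_space sW by (rule lie_rep_simps(7)[OF assms(1)])
  show ?thesis
    by (simp add: lie_rep_expand[OF assms(1), of "map_coeffs M (axis 1 v)"] * sum_UNIV_7 pos_simps)
qed

text \<open>A joint eigenvector of \<open>V g_1\<close> remains one after a twist, with reflected
  weight. One reflection turns each of the other two types into the vector type, and moving it to
  the other side yields \<open>rho2\<close> or \<open>rho3\<close>.\<close>

lemma classification:
  fixes sW :: "'a::{alg_closed_field, field_char_0} \<Rightarrow> 'w::ab_group_add \<Rightarrow> 'w"
  assumes irr: "irreducible_lie_rep scaleL bracket sW \<phi>" and dim: "vector_space.dim sW (UNIV :: 'w set) = 8"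
  shows "equivalent_reps sW \<phi> (*s) rho1 \<or> equivalent_reps sW \<phi> (*s) rho2 \<or> equivalent_reps sW \<phi> (*s) rho3"
proof -
  obtain im :: 'a where "im ^ 2 = - 1" using nth_root_exists[of 2 "- 1"] by auto
  then have im: "im * im = - 1" by (simp add: power2_eq_square)
  obtain B where B: "so8_irrep sW B im (\<lambda>p q. \<phi> (elt p q))"
    by (rule so8_irrep_of_lie_rep[OF irr dim im])
  interpret so8_irrep sW B im "\<lambda>p q. \<phi> (elt p q)" by (rule B)
  have lie: "lie_rep scaleL bracket sW \<phi>" using irr by (simp add: irreducible_lie_rep_def)
  have twist: "equivalent_reps sW \<phi> (*s) (\<lambda>x. rho1 (map_coeffs M x))"
    if M: "sigma_aut M" and v: "v \<noteq> 0"
      and ev: "\<phi> (elt 4 2) v = sW (- im * a) v" "\<phi> (elt 1 0) v = sW (- im * b) v"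
        "\<phi> (elt 7 3) v = sW (- im * c) v" "\<phi> (elt 6 5) v = sW (- im * d) v"
      \<comment> \<open>The left side is the weight of \<open>v\<close> evaluated at
        \<open>M z\<close>. The indices 1, 4, 2, 3 of \<open>V\<close> belong to the planes of
        \<open>weight_vector\<close> in its order.\<close>
      and m: "\<And>z k. z = axis k 1 \<Longrightarrow> a * M z $ 1 + c * M z $ 2 + d * M z $ 3 + b * M z $ 4 =
        (if k = 1 then of_int (m1 + m2) / 2 else if k = 4 then of_int (m1 - m2) / 2
         else if k = 2 then of_int (m3 + m4) / 2 else of_int (m3 - m4) / 2)"
      and parity: "even (m1 + m2)" "odd (m1 + m3)" "even (m3 + m4)"
    for M v a b c d m1 m2 m3 m4
  proof -
    let ?\<psi> = "\<lambda>x. \<phi> (map_coeffs M x)"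
    have irr': "irreducible_lie_rep scaleL bracket sW ?\<psi>"
      by (rule irreducible_map_coeffs[OF M irr])
    obtain B' where B': "so8_irrep sW B' im (\<lambda>p q. ?\<psi> (elt p q))"
      by (rule so8_irrep_of_lie_rep[OF irr' dim im])
    interpret tw: so8_irrep sW B' im "\<lambda>p q. ?\<psi> (elt p q)" by (rule B')
    have "?\<psi> (axis 1 z) v = sW (- im * (a * M z $ 1 + c * M z $ 2 + d * M z $ 3 + b * M z $ 4)) v" for z
      unfolding lie_rep_map_coeffs_axis[OF lie M] ev
      by (simp add: algebra_simps)
    then have "sW im (?\<psi> (axis 1 z) v) = sW (a * M z $ 1 + c * M z $ 2 + d * M z $ 3 + b * M z $ 4) v" for z
      unfolding scale_scale by (simp only: mult_minus_left mult_minus_right im_im_mult minus_minus scale_scale)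
    then have "tw.is_weight m1 m2 m3 m4 v"
      unfolding tw.is_weight_def tw.weight_vector_def tw.ev_def elt_cartan using v m by simp
    then have "tw.weights 1 1 0 0"
      using tw.weights_type1I parity unfolding tw.weights_def by blast
    then show ?thesis
      by (intro equivalent_map_coeffs[OF M] vector_type_equivalent[OF irr' B'])
  qed
  from weight_types show ?thesis
  proof (elim disjE)
    assume "weights 1 1 0 0"
    then show ?thesis using vector_type_equivalent[OF irr B] by blast
  next
    assume "weights 1 0 1 0"
    then obtain v where v: "v \<noteq> 0" "\<phi> (elt 4 2) v = sW (- im * (1 / 2)) v" "\<phi> (elt 1 0) v = sW (- im * (1 / 2)) v"
        "\<phi> (elt 7 3) v = sW (- im * (1 / 2)) v" "\<phi> (elt 6 5) v = sW (- im * (1 / 2)) v"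
      by (auto simp: weights_def is_weight_def weight_vector_def dest!: evD)
    have "equivalent_reps sW \<phi> (*s) (\<lambda>x. rho1 (map_coeffs refl2 x))"
      \<comment> \<open>In the order of coefficients the weight (1/2, 1/2, 1/2, 1/2) is reflected to
        (0, 0, 0, 1), whose integral coordinates are 1, -1, 0, 0.\<close>
      by (rule twist[OF sigma_aut_refl2 v, of 1 "- 1" 0 0])
        (use exhaust_4 in \<open>auto simp: refl2_nth axis_def\<close>)
    then show ?thesis by (simp flip: rho2_eq)
  next
    assume "weights 1 0 0 1"
    then obtain v where v: "v \<noteq> 0" "\<phi> (elt 4 2) v = sW (- im * (1 / 2)) v" "\<phi> (elt 1 0) v = sW (- im * (1 / 2)) v"
        "\<phi> (elt 7 3) v = sW (- im * (1 / 2)) v" "\<phi> (elt 6 5) v = sW (- im * (- 1 / 2)) v"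
      by (auto simp: weights_def is_weight_def weight_vector_def dest!: evD)
    have "equivalent_reps sW \<phi> (*s) (\<lambda>x. rho1 (map_coeffs refl3 x))"
      \<comment> \<open>Here (1/2, 1/2, -1/2, 1/2) is reflected to (0, 0, -1, 0), with integral
        coordinates 0, 0, -1, 1.\<close>
      by (rule twist[OF sigma_aut_refl3 v, of 0 0 "- 1" 1])
        (use exhaust_4 in \<open>auto simp: refl3_nth axis_def\<close>)
    then show ?thesis by (simp flip: rho3_eq)
  qed
qed

section \<open>Inequivalence by comparing kernels\<close>

lemma not_equivalentI:
  assumes "equivalent_reps (*s) \<phi> (*s) \<psi>" "\<phi> x w = 0" "\<And>v. \<psi> x v = 0 \<Longrightarrow> v = 0"
  shows "w = 0"
proof -
  obtain T where T: "Vector_Spaces.linear (*s) (*s) T" "bij T" "\<And>x v. T (\<phi> x v) = \<psi> x (T v)"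
    using assms(1) unfolding equivalent_reps_def by blast
  have "T 0 = 0" by (rule module_hom.zero[OF Vector_Spaces.linear.axioms(3)[OF T(1)]])
  moreover from this have "T w = 0" using T(3)[of x w] assms(2,3) by metis
  ultimately show ?thesis using T(2) by (metis bij_pointE)
qed

text \<open>With all four coefficients nonzero every plane is rotated, and no vector is
  killed.\<close>

lemma delta_regular:
  fixes v :: "'a::field ^ 4"
  assumes "delta 1 v w = 0" "v $ 1 \<noteq> 0" "v $ 2 \<noteq> 0" "v $ 3 \<noteq> 0" "v $ 4 \<noteq> 0"
  shows "w = 0"
proof -
  have "delta 1 v w $ k = 0" for k using assms(1) by simp
  from this[of 0] this[of 1] this[of 2] this[of 3] this[of 4] this[of 5] this[of 6] this[of 7]
  show ?thesis
    using assms(2-) by (simp add: delta_eq_so8_gen so8_gen_nth pos_simps vec_eq_8)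
qed

lemma map_coeffs_axis: "sigma_aut M \<Longrightarrow> rho1 (map_coeffs M (axis 1 v)) w = delta 1 (M v) w"
proof -
  assume M: "sigma_aut M"
  have M0: "M 0 = 0" using M unfolding sigma_aut_def by (metis vec.scale_zero_left)
  have "map_coeffs M (axis 1 v) = axis 1 (M v)"
    by (simp add: map_coeffs_def axis_def M0 vec_eq_iff[where 'b = 7])
  then show ?thesis by (simp add: rho1_axis_eq)
qed

text \<open>Under \<open>rho1\<close> the element with coefficient (0, 0, 0, 1) at
  \<open>g_1\<close> rotates only one plane and kills \<open>e_2\<close>. Both reflections turn its
  entries into 1/2 or -1/2, so \<open>rho2\<close> and \<open>rho3\<close> make it
  injective.\<close>

lemma inequivalent:
  shows "\<not> equivalent_reps (*s) (rho1 :: ('a::field_char_0 ^ 4) ^ 7 \<Rightarrow> 'a ^ 8 \<Rightarrow> 'a ^ 8) (*s) rho2"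
    "\<not> equivalent_reps (*s) (rho1 :: ('a ^ 4) ^ 7 \<Rightarrow> 'a ^ 8 \<Rightarrow> 'a ^ 8) (*s) rho3"
    "\<not> equivalent_reps (*s) (rho2 :: ('a ^ 4) ^ 7 \<Rightarrow> 'a ^ 8 \<Rightarrow> 'a ^ 8) (*s) rho3"
proof -
  let ?v = "axis 4 1 :: 'a ^ 4" and ?w = "ebas 2 :: 'a ^ 8"
  have ax: "?v $ 1 = 0" "?v $ 2 = 0" "?v $ 3 = 0" "?v $ 4 = 1" by (simp_all add: axis_def)
  have w: "?w \<noteq> 0" by (metis ebas_nth zero_index zero_neq_one)
  have 1: "rho1 (axis 1 ?v) ?w = 0"
    by (simp add: rho1_axis_axis vec_eq_iff so8_gen_nth ebas_nth pos_simps)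
  have 2: "v = 0" if "rho2 (axis 1 ?v) v = 0" for v
    by (rule delta_regular[of "refl2 ?v"])
      (use that in \<open>simp_all add: rho2_eq map_coeffs_axis sigma_aut_refl2 refl2_nth ax\<close>)
  have 3: "v = 0" if "rho3 (axis 1 ?v) v = 0" for v
    by (rule delta_regular[of "refl3 ?v"])
      (use that in \<open>simp_all add: rho3_eq map_coeffs_axis sigma_aut_refl3 refl3_nth ax\<close>)
  show "\<not> equivalent_reps (*s) (rho1 :: ('a ^ 4) ^ 7 \<Rightarrow> 'a ^ 8 \<Rightarrow> 'a ^ 8) (*s) rho2"
    using not_equivalentI[where \<phi> = rho1 and \<psi> = rho2 and x = "axis 1 ?v" and w = ?w] 1 2 w by blast
  show "\<not> equivalent_reps (*s) (rho1 :: ('a ^ 4) ^ 7 \<Rightarrow> 'a ^ 8 \<Rightarrow> 'a ^ 8) (*s) rho3"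
    using not_equivalentI[where \<phi> = rho1 and \<psi> = rho3 and x = "axis 1 ?v" and w = ?w] 1 3 w by blast
  \<comment> \<open>Reflecting the test element first makes \<open>rho2\<close> see (0, 0, 0, 1),
    while \<open>rho3\<close> sees four entries -1/2.\<close>
  have "refl2 (refl2 ?v) = ?v" by (simp add: sigma_aut_refl2[unfolded sigma_aut_def])
  then have 4: "rho2 (axis 1 (refl2 ?v)) ?w = 0"
    using 1 by (simp add: rho2_eq map_coeffs_axis sigma_aut_refl2 rho1_axis_eq)
  have 5: "v = 0" if "rho3 (axis 1 (refl2 ?v)) v = 0" for v
    by (rule delta_regular[of "refl3 (refl2 ?v)"])
      (use that in \<open>simp_all add: rho3_eq map_coeffs_axis sigma_aut_refl3 refl3_nth refl2_nth ax\<close>)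
  show "\<not> equivalent_reps (*s) (rho2 :: ('a ^ 4) ^ 7 \<Rightarrow> 'a ^ 8 \<Rightarrow> 'a ^ 8) (*s) rho3"
    using not_equivalentI[where \<phi> = rho2 and \<psi> = rho3 and x = "axis 1 (refl2 ?v)" and w = ?w] 4 5 w by blast
qed

theorem proposition2p10:
  shows
    "irreducible_lie_rep scaleL bracket (*s)
       (rho1 :: ('a::{alg_closed_field, field_char_0} ^ 4) ^ 7 \<Rightarrow> 'a ^ 8 \<Rightarrow> 'a ^ 8) \<and>
     irreducible_lie_rep scaleL bracket (*s)
       (rho2 :: ('a ^ 4) ^ 7 \<Rightarrow> 'a ^ 8 \<Rightarrow> 'a ^ 8) \<and>
     irreducible_lie_rep scaleL bracket (*s)
       (rho3 :: ('a ^ 4) ^ 7 \<Rightarrow> 'a ^ 8 \<Rightarrow> 'a ^ 8) \<and>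
     \<not> equivalent_reps (*s) (rho1 :: ('a ^ 4) ^ 7 \<Rightarrow> 'a ^ 8 \<Rightarrow> 'a ^ 8) (*s) rho2 \<and>
     \<not> equivalent_reps (*s) (rho1 :: ('a ^ 4) ^ 7 \<Rightarrow> 'a ^ 8 \<Rightarrow> 'a ^ 8) (*s) rho3 \<and>
     \<not> equivalent_reps (*s) (rho2 :: ('a ^ 4) ^ 7 \<Rightarrow> 'a ^ 8 \<Rightarrow> 'a ^ 8) (*s) rho3 \<and>
     (\<forall>(scaleW :: 'a \<Rightarrow> 'w::ab_group_add \<Rightarrow> 'w) (\<phi> :: ('a ^ 4) ^ 7 \<Rightarrow> 'w \<Rightarrow> 'w).
        irreducible_lie_rep scaleL bracket scaleW \<phi> \<and>
        vector_space.dim scaleW (UNIV :: 'w set) = 8 \<longrightarrow>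
        equivalent_reps scaleW \<phi> (*s) rho1 \<or>
        equivalent_reps scaleW \<phi> (*s) rho2 \<or>
        equivalent_reps scaleW \<phi> (*s) rho3)"
proof (intro conjI allI impI)
  show "irreducible_lie_rep scaleL bracket (*s) (rho1 :: ('a ^ 4) ^ 7 \<Rightarrow> 'a ^ 8 \<Rightarrow> 'a ^ 8)"
    by (rule irreducible_rho1)
  show "irreducible_lie_rep scaleL bracket (*s) (rho2 :: ('a ^ 4) ^ 7 \<Rightarrow> 'a ^ 8 \<Rightarrow> 'a ^ 8)"
    using irreducible_map_coeffs[OF sigma_aut_refl2 irreducible_rho1] by (simp flip: rho2_eq)
  show "irreducible_lie_rep scaleL bracket (*s) (rho3 :: ('a ^ 4) ^ 7 \<Rightarrow> 'a ^ 8 \<Rightarrow> 'a ^ 8)"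
    using irreducible_map_coeffs[OF sigma_aut_refl3 irreducible_rho1] by (simp flip: rho3_eq)
qed (use inequivalent classification in blast)+

end
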